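(* Let $G=G_{27}$ be the group of order $27$ with generators $\sigma,\tau$ and relations $\sigma^9=\tau^3=1$, $\tau\sigma=\sigma^4\tau$. Let $U$ be the elementary abelian subgroup generated by $\sigma^3$ and $\tau$, and let $H'$ be the cyclic subgroup of order $9$ generated by $\rho=\sigma\tau$. Let $G$ act by ring automorphisms on a ring $R$ and let $x\in R$ satisfy $N_U(x)=1$. Set $x_0=(1+\tau+\tau^2)(x)$ and $$\begin{aligned}x'={}&-x_0^2+2\rho(x_0)x_0-\rho^3(x_0)x_0+\rho^4(x_0)x_0+\sum_{j=3}^{8}x_0\,\rho^j(x_0)\,x_0\\&-\sum_{j=4}^{8}\rho(x_0)\rho^j(x_0)x_0-\rho(x_0)x_0^2+\sum_{j=6}^{8}\rho^3(x_0)\rho^j(x_0)x_0\\&-\rho^4(x_0)\rho^7(x_0)x_0-\rho^4(x_0)\rho^8(x_0)x_0-\rho^4(x_0)x_0^2,\end{aligned}$$ an element of $R$ satisfying $N_{H'}(x')=1$. Set $$b(\sigma)=(1+\sigma\tau+(\sigma\tau)^2)(x'),\qquad b(\tau)=(\tau-1)\bigl[\sigma^6-\sigma(1+\sigma+\sigma^2+\sigma^4)\tau\bigr](x'),$$ $$b(\sigma^3)=(1+\sigma+\sigma^2)b(\sigma)-1 .$$ Then one can find an element $w\in R$ such that $$b(\sigma^3)=(\sigma^3-1)w\quad\text{and}\quad b(\tau)=(\tau-1)w,$$ and $w$ can be expressed as a noncommutative polynomial with integer coefficients in terms of the norm one element $x$, the elements of $U$, and the values $b(\sigma)$, $b(\tau)$.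 Consequently, the element $a=b(\sigma)+(1-\sigma)(w)$ is $U$-invariant and satisfies $N_{G/U}(a)=(1+\sigma+\sigma^2)(a)=1$. Therefore $N_G(y)=1$ for $y=ax$ or $y=xa$.
   Context: Rings are associative with unit, not necessarily commutative. For a finite group $V$ acting on $R$ by ring automorphisms, $N_V(r)=\sum_{g\in V}g(r)$. The action of $G$ on $R$ is extended additively to an action of the group ring $\mathbf Z[G]$ on $R$. The quotient $G/U$ is cyclic of order $3$, generated by the class of $\sigma$, and acts on the subring $R^U$ of $U$-invariant elements.
   Formalization: The noncommutative polynomial for w is allowed to use U-translates of b(σ^3)=(1+σ+σ^2)b(σ)-1 in addition to those of x, b(σ), b(τ); with U-translates of x, b(σ), b(τ) alone the expressibility claim fails in a generic ring. *)

theory Defs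
  imports "HOL-Algebra.Algebra" "HOL-Library.Poly_Mapping"
begin

text \<open>
  The presented group has order exactly 27, so a group of order 27 generated by two elements
  satisfying the three relations is that group.
\<close>

locale G27 = group G for G (structure) +
  fixes \<sigma> \<tau>
  assumes sigma_closed: "\<sigma> \<in> carrier G"
    and tau_closed: "\<tau> \<in> carrier G"
    and generated: "generate G {\<sigma>, \<tau>} = carrier G"
    and order_27: "order G = 27"
    and sigma_pow: "\<sigma> [^] (9::nat) = \<one>"
    and tau_pow: "\<tau> [^] (3::nat) = \<one>"
    and tau_sigma: "\<tau> \<otimes> \<sigma> = \<sigma> [^] (4::nat) \<otimes> \<tau>"

definition subgroup_U :: "('g, 'm) monoid_scheme \<Rightarrow> 'g \<Rightarrow> 'g \<Rightarrow> 'g set" where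
  "subgroup_U G \<sigma> \<tau> = generate G {\<sigma> [^]\<^bsub>G\<^esub> (3::nat), \<tau>}"

definition subgroup_H' :: "('g, 'm) monoid_scheme \<Rightarrow> 'g \<Rightarrow> 'g \<Rightarrow> 'g set" where
  "subgroup_H' G \<sigma> \<tau> = generate G {\<sigma> \<otimes>\<^bsub>G\<^esub> \<tau>}"

locale ring_action = group_action G "carrier R" \<phi> + ring R
  for G :: "('g, 'm) monoid_scheme" and R :: "('r, 'n) ring_scheme"
    and \<phi> :: "'g \<Rightarrow> 'r \<Rightarrow> 'r" +
  assumes automorphism: "g \<in> carrier G \<Longrightarrow> \<phi> g \<in> ring_iso R R"

definition action_norm ::
  "('r, 'n) ring_scheme \<Rightarrow> ('h \<Rightarrow> 'r \<Rightarrow> 'r) \<Rightarrow> 'h set \<Rightarrow> 'r \<Rightarrow> 'r" where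
  "action_norm R \<psi> V r = (\<Oplus>\<^bsub>R\<^esub>g\<in>V. \<psi> g r)"

definition fixed_elements ::
  "('r, 'n) ring_scheme \<Rightarrow> ('g \<Rightarrow> 'r \<Rightarrow> 'r) \<Rightarrow> 'g set \<Rightarrow> 'r set" where
  "fixed_elements R \<phi> V = {r \<in> carrier R. \<forall>g\<in>V. \<phi> g r = r}"

text \<open>
  The action of a coset \<open>C\<close> of a normal subgroup \<open>V\<close>: on a \<open>V\<close>-invariant element \<open>r\<close>
  all representatives of \<open>C\<close> take the same value, so the image below is a singleton.
  Elsewhere the value is meaningless.
\<close>

definition coset_action :: "('g \<Rightarrow> 'r \<Rightarrow> 'r) \<Rightarrow> 'g set \<Rightarrow> 'r \<Rightarrow> 'r" where
  "coset_action \<phi> C r = the_elem ((\<lambda>g. \<phi> g r) ` C)"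

text \<open>
  Elements of the group ring act through the additive extension of \<open>\<phi>\<close>; for instance
  \<open>(\<tau> - 1)(r)\<close> is \<open>\<phi> \<tau> r \<ominus> r\<close>, and a product of group ring elements acts as the
  composition, rightmost factor first.
\<close>

context
  fixes G :: "('g, 'm) monoid_scheme"
    and R :: "('r, 'n) ring_scheme" (structure)
    and \<phi> :: "'g \<Rightarrow> 'r \<Rightarrow> 'r"
    and \<sigma> \<tau> :: 'g
begin

definition x_zero :: "'r \<Rightarrow> 'r" where
  "x_zero x = x \<oplus> \<phi> \<tau> x \<oplus> \<phi> (\<tau> [^]\<^bsub>G\<^esub> (2::nat)) x"

definition x_prime :: "'r \<Rightarrow> 'r" where
  "x_prime x =
    (let x\<^sub>0 = x_zero x;
         y = (\<lambda>j::nat. \<phi> ((\<sigma> \<otimes>\<^bsub>G\<^esub> \<tau>) [^]\<^bsub>G\<^esub> j) x\<^sub>0)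
     in (\<ominus> (x\<^sub>0 [^] (2::nat)))
        \<oplus> [(2::nat)] \<cdot> (y 1 \<otimes> x\<^sub>0)
        \<ominus> y 3 \<otimes> x\<^sub>0
        \<oplus> y 4 \<otimes> x\<^sub>0
        \<oplus> (\<Oplus>j\<in>{3..8}. x\<^sub>0 \<otimes> y j \<otimes> x\<^sub>0)
        \<ominus> (\<Oplus>j\<in>{4..8}. y 1 \<otimes> y j \<otimes> x\<^sub>0)
        \<ominus> y 1 \<otimes> x\<^sub>0 [^] (2::nat)
        \<oplus> (\<Oplus>j\<in>{6..8}. y 3 \<otimes> y j \<otimes> x\<^sub>0)
        \<ominus> y 4 \<otimes> y 7 \<otimes> x\<^sub>0
        \<ominus> y 4 \<otimes> y 8 \<otimes> x\<^sub>0
        \<ominus> y 4 \<otimes> x\<^sub>0 [^] (2::nat))"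

definition b_sigma :: "'r \<Rightarrow> 'r" where
  "b_sigma x =
    (let x' = x_prime x
     in x' \<oplus> \<phi> (\<sigma> \<otimes>\<^bsub>G\<^esub> \<tau>) x' \<oplus> \<phi> ((\<sigma> \<otimes>\<^bsub>G\<^esub> \<tau>) [^]\<^bsub>G\<^esub> (2::nat)) x')"

definition b_tau :: "'r \<Rightarrow> 'r" where
  "b_tau x =
    (let x' = x_prime x;
         t = \<phi> \<tau> x';
         v = \<phi> (\<sigma> [^]\<^bsub>G\<^esub> (6::nat)) x'
             \<ominus> \<phi> \<sigma> (t \<oplus> \<phi> \<sigma> t \<oplus> \<phi> (\<sigma> [^]\<^bsub>G\<^esub> (2::nat)) t \<oplus> \<phi> (\<sigma> [^]\<^bsub>G\<^esub> (4::nat)) t)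
     in \<phi> \<tau> v \<ominus> v)"

definition b_sigma3 :: "'r \<Rightarrow> 'r" where
  "b_sigma3 x =
    (b_sigma x \<oplus> \<phi> \<sigma> (b_sigma x) \<oplus> \<phi> (\<sigma> [^]\<^bsub>G\<^esub> (2::nat)) (b_sigma x)) \<ominus> \<one>"

definition a_elem :: "'r \<Rightarrow> 'r \<Rightarrow> 'r" where
  "a_elem x w = b_sigma x \<oplus> (w \<ominus> \<phi> \<sigma> w)"

definition solves_for_w :: "'r \<Rightarrow> 'r \<Rightarrow> bool" where
  "solves_for_w x w \<longleftrightarrow>
    w \<in> carrier R \<and>
    b_sigma3 x = \<phi> (\<sigma> [^]\<^bsub>G\<^esub> (3::nat)) w \<ominus> w \<and>
    b_tau x = \<phi> \<tau> w \<ominus> w"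

end

text \<open>
  A noncommutative polynomial with integer coefficients is a finitely supported integer function
  on words.
\<close>

definition nc_monomial :: "('r, 'n) ring_scheme \<Rightarrow> ('v \<Rightarrow> 'r) \<Rightarrow> 'v list \<Rightarrow> 'r" where
  "nc_monomial R f m = foldr (\<lambda>v r. f v \<otimes>\<^bsub>R\<^esub> r) m \<one>\<^bsub>R\<^esub>"

definition nc_eval ::
  "('r, 'n) ring_scheme \<Rightarrow> ('v \<Rightarrow> 'r) \<Rightarrow> ('v list \<Rightarrow>\<^sub>0 int) \<Rightarrow> 'r" where
  "nc_eval R f P =
    (\<Oplus>\<^bsub>R\<^esub>m\<in>Poly_Mapping.keys P. [Poly_Mapping.lookup P m] \<cdot>\<^bsub>R\<^esub> nc_monomial R f m)"

definition nc_variables :: "('v list \<Rightarrow>\<^sub>0 int) \<Rightarrow> 'v set" where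
  "nc_variables P = (\<Union>m\<in>Poly_Mapping.keys P. set m)"

text \<open>
  The variable \<open>(u, l)\<close> stands for the translate by \<open>u\<close> of the element named by \<open>l\<close>.
  The value \<open>b(\<sigma>\<^sup>3)\<close> needs its own letter: it involves translates of \<open>b(\<sigma>)\<close> by \<open>\<sigma>\<close>,
  and in general it is not a polynomial in translates by \<open>\<sigma>\<^sup>3\<close> and \<open>\<tau>\<close>
  of \<open>x\<close>, \<open>b(\<sigma>)\<close> and \<open>b(\<tau>)\<close>.
\<close>

datatype letter = Letter_x | Letter_b_sigma | Letter_b_tau | Letter_b_sigma3

definition letter_value ::
  "('g, 'm) monoid_scheme \<Rightarrow> ('r, 'n) ring_scheme \<Rightarrow> ('g \<Rightarrow> 'r \<Rightarrow> 'r) \<Rightarrow> 'g \<Rightarrow> 'g \<Rightarrow> 'r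
    \<Rightarrow> 'g \<times> letter \<Rightarrow> 'r" where
  "letter_value G R \<phi> \<sigma> \<tau> x v =
    \<phi> (fst v) (case snd v of
        Letter_x \<Rightarrow> x
      | Letter_b_sigma \<Rightarrow> b_sigma G R \<phi> \<sigma> \<tau> x
      | Letter_b_tau \<Rightarrow> b_tau G R \<phi> \<sigma> \<tau> x
      | Letter_b_sigma3 \<Rightarrow> b_sigma3 G R \<phi> \<sigma> \<tau> x)"

end

theory Submission
  imports Defs
begin

text \<open>
  Let \<open>\<rho> = \<sigma>\<tau>\<close> and \<open>y\<^sub>k = \<rho>\<^sup>k(x\<^sub>0)\<close>, so that \<open>y\<^sub>k + y\<^sub>k\<^sub>+\<^sub>3 + y\<^sub>k\<^sub>+\<^sub>6 = 1\<close>. The element \<open>x'\<close>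
  factors as \<open>l\<^sub>0 y\<^sub>0\<close> with \<open>l\<^sub>0 = y\<^sub>1 + (1 - \<rho>)(q\<^sub>0)\<close>, where
  \<open>q\<^sub>0 = y\<^sub>0(y\<^sub>3 + \<dots> + y\<^sub>8) - y\<^sub>0 - y\<^sub>3 + y\<^sub>3(y\<^sub>6 + y\<^sub>7 + y\<^sub>8)\<close>. Since
  \<open>(1 - \<rho>\<^sup>3)(q\<^sub>0) = 1 - y\<^sub>1 - y\<^sub>2 - y\<^sub>3\<close>, the left factor \<open>l\<^sub>0\<close> is fixed by \<open>\<rho>\<^sup>3\<close>. Hence the
  norm of \<open>x'\<close> over \<open>H'\<close> is \<open>l\<^sub>0 + \<rho>(l\<^sub>0) + \<rho>\<^sup>2(l\<^sub>0) = y\<^sub>1 + y\<^sub>2 + y\<^sub>3 + (1 - \<rho>\<^sup>3)(q\<^sub>0) = 1\<close>.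

  Linear identities in the translates of \<open>x'\<close> say that \<open>b\<close> satisfies the cocycle relations on the
  relators of \<open>G\<close>. So \<open>b\<close> extends to a cocycle on \<open>U\<close>, and \<open>w = -\<Sum>\<^sub>u b(u) u(x)\<close> has
  coboundary \<open>b\<close> because \<open>x\<close> has norm one. The relation \<open>b(\<tau>\<sigma>) = b(\<sigma>\<^sup>4\<tau>)\<close> makes \<open>a\<close>
  invariant under \<open>\<tau>\<close>.
\<close>

section \<open>Ring identities\<close>

context ring
begin

text \<open>Rewriting with these rules multiplies out, sorts the signed monomials and cancels
  opposite ones. Multiplication is only reassociated, since \<open>R\<close> need not be
  commutative.\<close>

lemmas ring_expand = minus_eq l_distr r_distr l_minus r_minus minus_add m_assoc
  a_assoc a_comm a_lcomm r_neg r_neg1 r_neg2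

lemma add_pow_2: "r \<in> carrier R \<Longrightarrow> [(2::nat)] \<cdot> r = r \<oplus> r"
  by (simp add: numeral_2_eq_2)

lemma nat_pow_2: "r \<in> carrier R \<Longrightarrow> r [^] (2::nat) = r \<otimes> r"
  by (simp add: numeral_2_eq_2)

lemma finsum_Times:
  assumes "finite A" "finite B" "\<And>a b. a \<in> A \<Longrightarrow> b \<in> B \<Longrightarrow> f (a, b) \<in> carrier R"
  shows "(\<Oplus>u\<in>A \<times> B. f u) = (\<Oplus>a\<in>A. \<Oplus>b\<in>B. f (a, b))"
  using assms(1,3)
proof (induction A)
  case (insert a A)
  have "insert a A \<times> B = Pair a ` B \<union> A \<times> B" by auto
  then have "(\<Oplus>u\<in>insert a A \<times> B. f u) = (\<Oplus>u\<in>Pair a ` B. f u) \<oplus> (\<Oplus>u\<in>A \<times> B. f u)"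
    using insert.hyps insert.prems assms(2) by (simp, intro finsum_Un_disjoint) auto
  also have "(\<Oplus>u\<in>Pair a ` B. f u) = (\<Oplus>b\<in>B. f (a, b))"
    using insert.prems by (intro finsum_reindex) (auto simp: inj_on_def)
  also have "(\<Oplus>u\<in>A \<times> B. f u) = (\<Oplus>a\<in>A. \<Oplus>b\<in>B. f (a, b))"
    using insert by auto
  also have "(\<Oplus>b\<in>B. f (a, b)) \<oplus> (\<Oplus>a\<in>A. \<Oplus>b\<in>B. f (a, b)) = (\<Oplus>a\<in>insert a A. \<Oplus>b\<in>B. f (a, b))"
    using insert.hyps insert.prems by (intro finsum_insert[symmetric]) (auto intro!: finsum_closed)
  finally show ?case .
qed simp

lemma minus_solve:
  assumes "a \<oplus> b \<oplus> c = \<zero>" "a \<in> carrier R" "b \<in> carrier R" "c \<in> carrier R"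
  shows "c = \<ominus> a \<ominus> b"
proof -
  have "c = (a \<oplus> b \<oplus> c) \<ominus> a \<ominus> b"
    using assms(2-) by algebra
  then show ?thesis
    using assms by (simp add: minus_eq)
qed

lemma add_solve: "\<lbrakk>a \<ominus> b = c; a \<in> carrier R; b \<in> carrier R\<rbrakk> \<Longrightarrow> a = b \<oplus> c"
  by (drule sym) algebra

text \<open>This is the formula for \<open>(1 - \<rho>^3)(q_0)\<close>, with \<open>a_j\<close> in
  the role of \<open>y_j\<close>. In blocks of three consecutive terms the products
  \<open>a3 \<otimes> t6\<close> cancel, and what remains meets only the full sum of the blocks,
  which is 3, and the sum \<open>a0 \<oplus> a3 \<oplus> a6\<close>, which is 1.\<close>

lemma norm_one_difference:
  assumes c: "a0 \<in> carrier R" "a1 \<in> carrier R" "a2 \<in> carrier R"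
      "a3 \<in> carrier R" "a4 \<in> carrier R" "a5 \<in> carrier R"
      "a6 \<in> carrier R" "a7 \<in> carrier R" "a8 \<in> carrier R"
    and s: "a0 \<oplus> a3 \<oplus> a6 = \<one>" "a1 \<oplus> a4 \<oplus> a7 = \<one>" "a2 \<oplus> a5 \<oplus> a8 = \<one>"
  shows "a0 \<otimes> (a3 \<oplus> a4 \<oplus> a5 \<oplus> a6 \<oplus> a7 \<oplus> a8) \<ominus> a0 \<ominus> a3 \<oplus> a3 \<otimes> (a6 \<oplus> a7 \<oplus> a8)
      \<ominus> (a3 \<otimes> (a6 \<oplus> a7 \<oplus> a8 \<oplus> a0 \<oplus> a1 \<oplus> a2) \<ominus> a3 \<ominus> a6 \<oplus> a6 \<otimes> (a0 \<oplus> a1 \<oplus> a2))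
    = \<one> \<ominus> (a1 \<oplus> a2 \<oplus> a3)" (is "?L = _")
proof -
  define t0 where "t0 = a0 \<oplus> a1 \<oplus> a2"
  define t3 where "t3 = a3 \<oplus> a4 \<oplus> a5"
  define t6 where "t6 = a6 \<oplus> a7 \<oplus> a8"
  have t: "t0 \<in> carrier R" "t3 \<in> carrier R" "t6 \<in> carrier R"
    using c by (simp_all add: t0_def t3_def t6_def)
  have "t0 \<oplus> t3 \<oplus> t6 = (a0 \<oplus> a3 \<oplus> a6) \<oplus> (a1 \<oplus> a4 \<oplus> a7) \<oplus> (a2 \<oplus> a5 \<oplus> a8)"
    unfolding t0_def t3_def t6_def using c by algebra
  then have total: "t0 \<oplus> t3 \<oplus> t6 = \<one> \<oplus> \<one> \<oplus> \<one>"
    by (simp only: s)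
  have "?L = a0 \<otimes> (t3 \<oplus> t6) \<ominus> a0 \<ominus> a3 \<oplus> a3 \<otimes> t6 \<ominus> (a3 \<otimes> (t6 \<oplus> t0) \<ominus> a3 \<ominus> a6 \<oplus> a6 \<otimes> t0)"
    unfolding t0_def t3_def t6_def using c by (simp add: a_assoc)
  also have "\<dots> = a0 \<otimes> (t0 \<oplus> t3 \<oplus> t6) \<ominus> (a0 \<oplus> a3 \<oplus> a6) \<otimes> t0 \<ominus> a0 \<oplus> a6"
    using c(1,4,7) t by algebra
  also have "\<dots> = a0 \<otimes> (\<one> \<oplus> \<one> \<oplus> \<one>) \<ominus> \<one> \<otimes> t0 \<ominus> a0 \<oplus> a6"
    by (simp only: total s)
  also have "\<dots> = (a0 \<oplus> a0 \<oplus> a0) \<ominus> t0 \<ominus> a0 \<oplus> a6"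
    using c(1) t(1) by (simp add: r_distr)
  also have "\<dots> = (a0 \<oplus> a3 \<oplus> a6) \<ominus> (a1 \<oplus> a2 \<oplus> a3)"
    unfolding t0_def using c(1-4,7) by algebra
  finally show ?thesis
    by (simp only: s)
qed

text \<open>The norm computation for \<open>x'\<close>, stripped of the group action:
  \<open>y\<close> is any sequence of period 9 whose sums along steps of 3 are 1. As
  \<open>l\<close> has period 3, each of \<open>l 0\<close>, \<open>l 1\<close>, \<open>l 2\<close>
  factors out on the left of such a sum.\<close>

lemma norm_one_element:
  assumes y: "\<And>j::nat. y j \<in> carrier R"
    and trace: "\<And>j. y j \<oplus> y (j + 3) \<oplus> y (j + 6) = \<one>"
    and period: "\<And>j. y (j + 9) = y j"
  defines "q \<equiv> \<lambda>k. y k \<otimes> (y (k+3) \<oplus> y (k+4) \<oplus> y (k+5) \<oplus> y (k+6) \<oplus> y (k+7) \<oplus> y (k+8))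
      \<ominus> y k \<ominus> y (k+3) \<oplus> y (k+3) \<otimes> (y (k+6) \<oplus> y (k+7) \<oplus> y (k+8))"
  defines "l \<equiv> \<lambda>k. y (k+1) \<oplus> (q k \<ominus> q (k+1))"
  shows "(\<Oplus>k\<in>{..<9}. l k \<otimes> y k) = \<one>"
proof -
  have q: "q k \<in> carrier R" for k
    unfolding q_def using y by simp
  then have l: "l k \<in> carrier R" for k
    unfolding l_def using y by simp
  have q3: "q k \<ominus> q (k+3) = \<one> \<ominus> (y (k+1) \<oplus> y (k+2) \<oplus> y (k+3))" for k
  proof -
    \<comment> \<open>In \<open>q (k+3)\<close> the indices from \<open>k + 9\<close> on wrap around
      to \<open>k\<close>, \<open>k+1\<close>, \<open>k+2\<close> by periodicity.\<close>
    have shift: "k + 3 + 3 = k + 6" "k + 3 + 4 = k + 7" "k + 3 + 5 = k + 8"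
      "k + 3 + 6 = k + 9" "k + 3 + 7 = k + 1 + 9" "k + 3 + 8 = k + 2 + 9"
      by simp_all
    have "y (k+1) \<oplus> y (k+4) \<oplus> y (k+7) = \<one>" "y (k+2) \<oplus> y (k+5) \<oplus> y (k+8) = \<one>"
      using trace[of "k+1"] trace[of "k+2"] by (simp_all only: add.assoc) simp_all
    then show ?thesis
      unfolding q_def shift period
      using norm_one_difference[OF y y y y y y y y y trace] by blast
  qed
  have l3: "l (k+3) = l k" for k
  proof -
    \<comment> \<open>The sides differ by
      \<open>(u0 \<ominus> u3) \<ominus> (u1 \<ominus> u4)\<close> and
      \<open>b4 \<ominus> b1\<close>; by \<open>q3\<close> at two consecutive indices these are
      equal.\<close>
    have id: "b1 \<oplus> (u0 \<ominus> u1) = b4 \<oplus> (u3 \<ominus> u4)"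
      if e: "u0 \<ominus> u3 = \<one> \<ominus> (b1 \<oplus> b2 \<oplus> b3)" "u1 \<ominus> u4 = \<one> \<ominus> (b2 \<oplus> b3 \<oplus> b4)"
        and c: "u0 \<in> carrier R" "u1 \<in> carrier R" "u3 \<in> carrier R" "u4 \<in> carrier R"
          "b1 \<in> carrier R" "b2 \<in> carrier R" "b3 \<in> carrier R" "b4 \<in> carrier R"
      for u0 u1 u3 u4 b1 b2 b3 b4
    proof -
      have "b1 \<oplus> (u0 \<ominus> u1) = b1 \<oplus> (u3 \<ominus> u4) \<oplus> ((u0 \<ominus> u3) \<ominus> (u1 \<ominus> u4))"
        using c by algebra
      also have "\<dots> = b4 \<oplus> (u3 \<ominus> u4)"
        unfolding e using c(3-) by algebra
      finally show ?thesis .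
    qed
    have shift: "k + 1 + 1 = k + 2" "k + 1 + 2 = k + 3" "k + 1 + 3 = k + 4" "k + 3 + 1 = k + 4"
      by simp_all
    show ?thesis
      unfolding l_def shift
      by (rule id[symmetric, OF q3 q3[of "k+1", unfolded shift] q q q q y y y y])
  qed
  have "(\<Oplus>k\<in>{..<9}. l k \<otimes> y k) = (\<Oplus>k\<in>{..<3}. l k \<otimes> (y k \<oplus> y (k+3) \<oplus> y (k+6)))"
  proof -
    have "l 3 = l 0" "l 4 = l 1" "l 5 = l 2" "l 6 = l 0" "l 7 = l 1" "l 8 = l 2"
      using l3[of 0] l3[of 1] l3[of 2] l3[of 3] l3[of 4] l3[of 5] by simp_all
    then show ?thesis
      using y l by (simp add: lessThan_nat_numeral lessThan_Suc r_distr a_ac)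
  qed
  also have "\<dots> = l 0 \<oplus> l 1 \<oplus> l 2"
    using l by (simp add: trace lessThan_nat_numeral lessThan_Suc a_ac)
  also have "\<dots> = y 1 \<oplus> y 2 \<oplus> y 3 \<oplus> (q 0 \<ominus> q 3)"
  proof -
    \<comment> \<open>The differences of consecutive \<open>q\<close> telescope.\<close>
    have "b1 \<oplus> (u0 \<ominus> u1) \<oplus> (b2 \<oplus> (u1 \<ominus> u2)) \<oplus> (b3 \<oplus> (u2 \<ominus> u3)) = b1 \<oplus> b2 \<oplus> b3 \<oplus> (u0 \<ominus> u3)"
      if "u0 \<in> carrier R" "u1 \<in> carrier R" "u2 \<in> carrier R" "u3 \<in> carrier R"
        "b1 \<in> carrier R" "b2 \<in> carrier R" "b3 \<in> carrier R"
      for u0 u1 u2 u3 b1 b2 b3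
      using that by algebra
    from this[OF q q q q y y y] show ?thesis
      unfolding l_def by (simp add: numeral_2_eq_2[symmetric])
  qed
  also have "\<dots> = \<one>"
  proof -
    have "q 0 \<ominus> q 3 = \<one> \<ominus> (y 1 \<oplus> y 2 \<oplus> y 3)"
      using q3[of 0] by (simp only: add_0)
    moreover have "b \<oplus> (\<one> \<ominus> b) = \<one>" if "b \<in> carrier R" for b
      using that by algebra
    ultimately show ?thesis
      using y by simp
  qed
  finally show ?thesis .
qed

end

section \<open>Evaluation of noncommutative polynomials\<close>

lemma nc_variables_sum: "nc_variables (\<Sum>i\<in>I. P i) \<subseteq> (\<Union>i\<in>I. nc_variables (P i))"
  using keys_sum[of P I] by (force simp: nc_variables_def)

lemma nc_variables_add: "nc_variables (P + Q) \<subseteq> nc_variables P \<union> nc_variables Q"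
  using keys_add[of P Q] by (force simp: nc_variables_def)

lemma nc_variables_single: "nc_variables (Poly_Mapping.single m c) \<subseteq> set m"
  by (simp add: nc_variables_def)

context ring
begin

lemma nc_monomial_closed:
  "\<lbrakk>f \<in> V \<rightarrow> carrier R; set m \<subseteq> V\<rbrakk> \<Longrightarrow> nc_monomial R f m \<in> carrier R"
  by (induction m) (auto simp: nc_monomial_def)

text \<open>Coefficients may cancel in a sum, so the supports of \<open>P\<close>, \<open>Q\<close>
  and \<open>P + Q\<close> differ. Evaluating over one common finite set of words makes additivity a
  termwise statement.\<close>

lemma nc_eval_superset:
  assumes "f \<in> V \<rightarrow> carrier R" "finite K" "Poly_Mapping.keys P \<subseteq> K" "K \<subseteq> lists V"
  shows "nc_eval R f P = (\<Oplus>m\<in>K. [Poly_Mapping.lookup P m] \<cdot> nc_monomial R f m)"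
proof -
  have "[(0::int)] \<cdot> r = \<zero>" for r
    by (simp add: add_pow_def)
  moreover have "nc_monomial R f m \<in> carrier R" if "m \<in> K" for m
    using that assms by (intro nc_monomial_closed) auto
  ultimately show ?thesis
    unfolding nc_eval_def using assms
    by (intro add.finprod_mono_neutral_cong_left) (auto simp: in_keys_iff)
qed

lemma nc_variables_lists: "nc_variables P \<subseteq> V \<longleftrightarrow> Poly_Mapping.keys P \<subseteq> lists V"
  by (auto simp: nc_variables_def)

lemma nc_eval_closed:
  assumes "f \<in> V \<rightarrow> carrier R" "nc_variables P \<subseteq> V"
  shows "nc_eval R f P \<in> carrier R"
proof -
  have "nc_monomial R f m \<in> carrier R" if "m \<in> Poly_Mapping.keys P" for m
    using that assms by (intro nc_monomial_closed) (auto simp: nc_variables_def)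
  then show ?thesis
    unfolding nc_eval_def by (intro finsum_closed) auto
qed

lemma nc_eval_zero [simp]: "nc_eval R f 0 = \<zero>"
  by (simp add: nc_eval_def)

lemma nc_eval_add:
  assumes f: "f \<in> V \<rightarrow> carrier R" and V: "nc_variables P \<subseteq> V" "nc_variables Q \<subseteq> V"
  shows "nc_eval R f (P + Q) = nc_eval R f P \<oplus> nc_eval R f Q"
proof -
  let ?K = "Poly_Mapping.keys P \<union> Poly_Mapping.keys Q"
  have K: "?K \<subseteq> lists V" using V by (simp add: nc_variables_lists)
  have eval: "nc_eval R f S = (\<Oplus>m\<in>?K. [Poly_Mapping.lookup S m] \<cdot> nc_monomial R f m)"
    if "Poly_Mapping.keys S \<subseteq> ?K" for S
    using that f K by (intro nc_eval_superset) auto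
  have "nc_monomial R f m \<in> carrier R" if "m \<in> ?K" for m
    using that f K by (intro nc_monomial_closed) auto
  then have mon: "[c] \<cdot> nc_monomial R f m \<in> carrier R"
    "[(c + d)] \<cdot> nc_monomial R f m = [c] \<cdot> nc_monomial R f m \<oplus> [d] \<cdot> nc_monomial R f m"
    if "m \<in> ?K" for m and c d :: int
    using that by (simp_all add: add.int_pow_mult)
  have "nc_eval R f (P + Q) = (\<Oplus>m\<in>?K. [Poly_Mapping.lookup P m] \<cdot> nc_monomial R f m
      \<oplus> [Poly_Mapping.lookup Q m] \<cdot> nc_monomial R f m)"
    unfolding eval[OF keys_add] using mon by (intro finsum_cong') (auto simp: lookup_add)
  also have "\<dots> = nc_eval R f P \<oplus> nc_eval R f Q"
    unfolding eval[OF Un_upper1] eval[OF Un_upper2] using mon by (intro finsum_addf) auto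
  finally show ?thesis .
qed

lemma nc_eval_sum:
  assumes f: "f \<in> V \<rightarrow> carrier R" and "finite I" and V: "\<And>i. i \<in> I \<Longrightarrow> nc_variables (P i) \<subseteq> V"
  shows "nc_eval R f (\<Sum>i\<in>I. P i) = (\<Oplus>i\<in>I. nc_eval R f (P i))"
  using \<open>finite I\<close> V
proof induction
  case (insert i I)
  have "nc_variables (\<Sum>i\<in>I. P i) \<subseteq> V"
    using insert.prems nc_variables_sum[of P I] by blast
  with insert f show ?case
    by (simp add: nc_eval_add nc_eval_closed Pi_iff)
qed simp

lemma nc_eval_single:
  assumes f: "f \<in> V \<rightarrow> carrier R" and m: "set m \<subseteq> V"
  shows "nc_eval R f (Poly_Mapping.single m c) = [c] \<cdot> nc_monomial R f m"
  using nc_eval_superset[of f V "{m}" "Poly_Mapping.single m c"] nc_monomial_closed[OF f m] f m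
  by (simp add: in_lists_conv_set subset_iff)

end

section \<open>Group actions on rings\<close>

context ring_action
begin

lemma action_closed [simp]: "g \<in> carrier G \<Longrightarrow> r \<in> carrier R \<Longrightarrow> \<phi> g r \<in> carrier R"
  using automorphism by (auto simp: ring_iso_def dest: ring_hom_closed)

lemma action_ring_hom: "g \<in> carrier G \<Longrightarrow> ring_hom_ring R R (\<phi> g)"
  using automorphism ring_axioms by (auto intro!: ring_hom_ringI2 simp: ring_iso_def)

lemma action_comp:
  "\<lbrakk>g \<in> carrier G; h \<in> carrier G; r \<in> carrier R\<rbrakk> \<Longrightarrow> \<phi> g (\<phi> h r) = \<phi> (g \<otimes>\<^bsub>G\<^esub> h) r"
  by (simp add: composition_rule)

lemma action_one: "r \<in> carrier R \<Longrightarrow> \<phi> \<one>\<^bsub>G\<^esub> r = r"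
  by (metis id_eq_one restrict_apply')

lemma action_add:
  "\<lbrakk>g \<in> carrier G; r \<in> carrier R; s \<in> carrier R\<rbrakk> \<Longrightarrow> \<phi> g (r \<oplus>\<^bsub>R\<^esub> s) = \<phi> g r \<oplus>\<^bsub>R\<^esub> \<phi> g s"
  using automorphism by (auto simp: ring_iso_def intro: ring_hom_add)

lemma action_mult:
  "\<lbrakk>g \<in> carrier G; r \<in> carrier R; s \<in> carrier R\<rbrakk> \<Longrightarrow> \<phi> g (r \<otimes>\<^bsub>R\<^esub> s) = \<phi> g r \<otimes>\<^bsub>R\<^esub> \<phi> g s"
  using automorphism by (auto simp: ring_iso_def intro: ring_hom_mult)

lemma action_ring_one: "g \<in> carrier G \<Longrightarrow> \<phi> g \<one>\<^bsub>R\<^esub> = \<one>\<^bsub>R\<^esub>"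
  using automorphism by (auto simp: ring_iso_def intro: ring_hom_one)

lemma action_a_inv: "\<lbrakk>g \<in> carrier G; r \<in> carrier R\<rbrakk> \<Longrightarrow> \<phi> g (\<ominus>\<^bsub>R\<^esub> r) = \<ominus>\<^bsub>R\<^esub> \<phi> g r"
proof -
  assume g: "g \<in> carrier G" and r: "r \<in> carrier R"
  interpret h: ring_hom_ring R R "\<phi> g" by (rule action_ring_hom[OF g])
  show ?thesis using r by simp
qed

lemma action_finsum:
  "\<lbrakk>g \<in> carrier G; f \<in> I \<rightarrow> carrier R\<rbrakk> \<Longrightarrow> \<phi> g (\<Oplus>\<^bsub>R\<^esub>i\<in>I. f i) = (\<Oplus>\<^bsub>R\<^esub>i\<in>I. \<phi> g (f i))"
proof -
  assume g: "g \<in> carrier G" and f: "f \<in> I \<rightarrow> carrier R"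
  interpret h: ring_hom_ring R R "\<phi> g" by (rule action_ring_hom[OF g])
  show ?thesis using f by (simp add: comp_def)
qed

text \<open>Additive Hilbert 90: \<open>g\<close> permutes the \<open>z i\<close>, and on the
  coefficients it differs from the same permutation by the constant \<open>b\<close>. Reindexing
  gives \<open>\<phi> g w = b \<otimes> (\<Sum> z i) + w\<close>, and the \<open>z i\<close> sum to
  one. For a cocycle the coefficients are its negated values, whence the sign in
  \<open>cocycle\<close>.\<close>

lemma coboundary:
  assumes g: "g \<in> carrier G"
    and "finite I" and \<pi>: "bij_betw \<pi> I I"
    and c: "c \<in> I \<rightarrow> carrier R" and z: "z \<in> I \<rightarrow> carrier R" and b: "b \<in> carrier R"
    and shift: "\<And>i. i \<in> I \<Longrightarrow> \<phi> g (z i) = z (\<pi> i)"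
    and cocycle: "\<And>i. i \<in> I \<Longrightarrow> \<phi> g (c i) = b \<oplus>\<^bsub>R\<^esub> c (\<pi> i)"
    and norm: "(\<Oplus>\<^bsub>R\<^esub>i\<in>I. z i) = \<one>\<^bsub>R\<^esub>"
  defines "w \<equiv> \<Oplus>\<^bsub>R\<^esub>i\<in>I. c i \<otimes>\<^bsub>R\<^esub> z i"
  shows "\<phi> g w \<ominus>\<^bsub>R\<^esub> w = b"
proof -
  have \<pi>I: "\<pi> i \<in> I" if "i \<in> I" for i
    using \<pi> that by (auto simp: bij_betw_def)
  have cc: "c i \<in> carrier R" and zc: "z i \<in> carrier R" if "i \<in> I" for i
    using that c z by auto
  have reindex: "(\<Oplus>\<^bsub>R\<^esub>i\<in>I. f (\<pi> i)) = (\<Oplus>\<^bsub>R\<^esub>i\<in>I. f i)" if "f \<in> I \<rightarrow> carrier R" for f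
    using finsum_reindex[of f \<pi> I] \<pi> that by (simp add: bij_betw_def)
  have "\<phi> g w = (\<Oplus>\<^bsub>R\<^esub>i\<in>I. \<phi> g (c i \<otimes>\<^bsub>R\<^esub> z i))"
    unfolding w_def using g cc zc by (intro action_finsum) auto
  also have "\<dots> = (\<Oplus>\<^bsub>R\<^esub>i\<in>I. b \<otimes>\<^bsub>R\<^esub> z (\<pi> i) \<oplus>\<^bsub>R\<^esub> c (\<pi> i) \<otimes>\<^bsub>R\<^esub> z (\<pi> i))"
    using g b cc zc \<pi>I
    by (intro finsum_cong') (auto simp: cocycle shift action_mult l_distr)
  also have "\<dots> = (\<Oplus>\<^bsub>R\<^esub>i\<in>I. b \<otimes>\<^bsub>R\<^esub> z (\<pi> i)) \<oplus>\<^bsub>R\<^esub> (\<Oplus>\<^bsub>R\<^esub>i\<in>I. c (\<pi> i) \<otimes>\<^bsub>R\<^esub> z (\<pi> i))"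
    using b cc zc \<pi>I by (intro finsum_addf) auto
  also have "(\<Oplus>\<^bsub>R\<^esub>i\<in>I. b \<otimes>\<^bsub>R\<^esub> z (\<pi> i)) = (\<Oplus>\<^bsub>R\<^esub>i\<in>I. b \<otimes>\<^bsub>R\<^esub> z i)"
    using b zc by (intro reindex) auto
  also have "\<dots> = b"
    using finsum_rdistr[OF \<open>finite I\<close> b z] b by (simp add: norm)
  also have "(\<Oplus>\<^bsub>R\<^esub>i\<in>I. c (\<pi> i) \<otimes>\<^bsub>R\<^esub> z (\<pi> i)) = w"
    unfolding w_def using cc zc by (intro reindex) auto
  finally have *: "\<phi> g w = b \<oplus>\<^bsub>R\<^esub> w" .
  have w: "w \<in> carrier R"
    unfolding w_def using cc zc by (intro finsum_closed) auto
  show ?thesis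
    unfolding * using b w by algebra
qed

end

section \<open>Normal forms in the group of order 27\<close>

context G27
begin

text \<open>The exponents are arbitrary natural numbers; \<open>word_mult\<close> returns reduced
  ones, so that computing in the group becomes arithmetic on numerals.\<close>

definition word :: "nat \<Rightarrow> nat \<Rightarrow> 'a" where
  "word i j = \<sigma> [^] i \<otimes> \<tau> [^] j"

lemma word_closed [simp]: "word i j \<in> carrier G"
  by (simp add: word_def sigma_closed tau_closed)

lemma tau_pow_sigma_pow: "\<tau> [^] (j::nat) \<otimes> \<sigma> [^] (k::nat) = \<sigma> [^] (4 ^ j * k) \<otimes> \<tau> [^] j"
proof -
  note c = sigma_closed tau_closed
  have tau: "\<tau> \<otimes> \<sigma> [^] k = \<sigma> [^] (4 * k) \<otimes> \<tau>" for k :: nat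
  proof (induction k)
    case (Suc k)
    have "\<tau> \<otimes> \<sigma> [^] Suc k = (\<tau> \<otimes> \<sigma> [^] k) \<otimes> \<sigma>"
      using c by (simp add: m_assoc)
    also have "\<dots> = \<sigma> [^] (4 * k) \<otimes> (\<tau> \<otimes> \<sigma>)"
      using c by (simp add: Suc m_assoc)
    also have "\<dots> = \<sigma> [^] (4 * k + 4) \<otimes> \<tau>"
      using c by (simp add: tau_sigma nat_pow_mult[symmetric] m_assoc)
    finally show ?case by (simp add: add.commute)
  qed (use c in simp)
  show ?thesis
  proof (induction j arbitrary: k)
    case (Suc j)
    have "\<tau> [^] Suc j \<otimes> \<sigma> [^] k = \<tau> [^] j \<otimes> (\<tau> \<otimes> \<sigma> [^] k)"
      using c by (simp add: m_assoc)
    also have "\<dots> = (\<tau> [^] j \<otimes> \<sigma> [^] (4 * k)) \<otimes> \<tau>"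
      using c by (simp add: tau m_assoc)
    also have "\<dots> = \<sigma> [^] (4 ^ Suc j * k) \<otimes> \<tau> [^] Suc j"
      unfolding Suc using c by (simp add: m_assoc mult_ac)
    finally show ?case .
  qed (use c in simp)
qed

lemma pow_mod: "\<lbrakk>a \<in> carrier G; a [^] m = \<one>\<rbrakk> \<Longrightarrow> a [^] (i mod m) = a [^] i" for i m :: nat
proof -
  assume a: "a \<in> carrier G" "a [^] m = \<one>"
  then have "a [^] (i mod m) = (a [^] m) [^] (i div m) \<otimes> a [^] (i mod m)"
    by simp
  also have "\<dots> = a [^] (m * (i div m) + i mod m)"
    using a(1) by (simp only: nat_pow_pow nat_pow_mult nat_pow_closed)
  finally show "a [^] (i mod m) = a [^] i" by simp
qed

text \<open>Multiplication in the semidirect product of Z/9 by Z/3: conjugation by \<tau> raises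
  \<sigma> to its fourth power.\<close>

lemma word_mult: "word i j \<otimes> word k l = word ((i + 4 ^ j * k) mod 9) ((j + l) mod 3)"
proof -
  note c = sigma_closed tau_closed
  have "word i j \<otimes> word k l = \<sigma> [^] i \<otimes> (\<tau> [^] j \<otimes> \<sigma> [^] k) \<otimes> \<tau> [^] l"
    using c by (simp add: word_def m_assoc)
  also have "\<dots> = (\<sigma> [^] i \<otimes> \<sigma> [^] (4 ^ j * k)) \<otimes> (\<tau> [^] j \<otimes> \<tau> [^] l)"
    unfolding tau_pow_sigma_pow using c by (simp add: m_assoc)
  also have "\<dots> = word ((i + 4 ^ j * k) mod 9) ((j + l) mod 3)"
    using c by (simp add: word_def nat_pow_mult pow_mod sigma_pow tau_pow)
  finally show ?thesis .
qed

lemma word_0_0: "word 0 0 = \<one>"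
  by (simp add: word_def)

lemma sigma_pow_word: "\<sigma> [^] i = word i 0"
  by (simp add: word_def sigma_closed)

lemma word_sigma: "word 1 0 = \<sigma>"
  by (simp add: word_def sigma_closed)

lemma tau_pow_word: "\<tau> [^] j = word 0 j"
  by (simp add: word_def tau_closed)

lemma word_tau: "word 0 1 = \<tau>"
  by (simp add: word_def tau_closed)

lemma sigma_tau_word: "\<sigma> \<otimes> \<tau> = word 1 1"
  by (simp add: word_def sigma_closed tau_closed)

lemma sigma_tau_closed: "\<sigma> \<otimes> \<tau> \<in> carrier G"
  by (simp add: sigma_closed tau_closed)

lemma sigma_tau_pow_add: "(\<sigma> \<otimes> \<tau>) [^] k \<otimes> (\<sigma> \<otimes> \<tau>) [^] l = (\<sigma> \<otimes> \<tau>) [^] (k + l)"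
  for k l :: nat
  by (simp add: sigma_tau_closed nat_pow_mult)

text \<open>The entry to note is \<open>\<rho>^3 = \<sigma>^3\<close>: the cube of \<rho> lies in
  \<open>U\<close>, which ties norms over \<open>H'\<close> to norms over \<open>U\<close>.\<close>

lemma sigma_tau_pow_word:
  "(\<sigma> \<otimes> \<tau>) [^] (2::nat) = word 5 2" "(\<sigma> \<otimes> \<tau>) [^] (3::nat) = word 3 0"
  "(\<sigma> \<otimes> \<tau>) [^] (4::nat) = word 4 1" "(\<sigma> \<otimes> \<tau>) [^] (5::nat) = word 8 2"
  "(\<sigma> \<otimes> \<tau>) [^] (6::nat) = word 6 0" "(\<sigma> \<otimes> \<tau>) [^] (7::nat) = word 7 1"
  "(\<sigma> \<otimes> \<tau>) [^] (8::nat) = word 2 2" "(\<sigma> \<otimes> \<tau>) [^] (9::nat) = \<one>"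
proof -
  note c = sigma_tau_closed
  have step: "(\<sigma> \<otimes> \<tau>) [^] m = word k l"
    if "(\<sigma> \<otimes> \<tau>) [^] n = word i j" "m = Suc n" "k = (i + 4 ^ j) mod 9" "l = (j + 1) mod 3"
    for m n i j k l :: nat
    using that by (simp add: sigma_tau_word word_mult)
  have 1: "(\<sigma> \<otimes> \<tau>) [^] (1::nat) = word 1 1" using c by (simp add: sigma_tau_word)
  show 2: "(\<sigma> \<otimes> \<tau>) [^] (2::nat) = word 5 2" by (rule step[OF 1]) simp_all
  show 3: "(\<sigma> \<otimes> \<tau>) [^] (3::nat) = word 3 0" by (rule step[OF 2]) simp_all
  show 4: "(\<sigma> \<otimes> \<tau>) [^] (4::nat) = word 4 1" by (rule step[OF 3]) simp_all
  show 5: "(\<sigma> \<otimes> \<tau>) [^] (5::nat) = word 8 2" by (rule step[OF 4]) simp_all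
  show 6: "(\<sigma> \<otimes> \<tau>) [^] (6::nat) = word 6 0" by (rule step[OF 5]) simp_all
  show 7: "(\<sigma> \<otimes> \<tau>) [^] (7::nat) = word 7 1" by (rule step[OF 6]) simp_all
  show 8: "(\<sigma> \<otimes> \<tau>) [^] (8::nat) = word 2 2" by (rule step[OF 7]) simp_all
  show "(\<sigma> \<otimes> \<tau>) [^] (9::nat) = \<one>" unfolding word_0_0[symmetric] by (rule step[OF 8]) simp_all
qed

text \<open>In a group of order 27 the inverse of \<open>h\<close> is \<open>h^26\<close>, so
  closure under products already yields closure under inverses.\<close>

lemma generate_subset:
  assumes S: "S \<subseteq> carrier G" "\<one> \<in> S" "A \<subseteq> S"
    and mult: "\<And>g h. g \<in> S \<Longrightarrow> h \<in> S \<Longrightarrow> g \<otimes> h \<in> S"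
  shows "generate G A \<subseteq> S"
proof
  have pow: "h [^] n \<in> S" if "h \<in> S" for h and n :: nat
    using that S mult by (induction n) auto
  have inv: "inv h \<in> S" if "h \<in> S" for h
  proof -
    have h: "h \<in> carrier G" using that S by blast
    have "h [^] (26::nat) \<otimes> h = h [^] order G"
      using h nat_pow_mult[of h 26 1] by (simp add: order_27)
    then have "inv h = h [^] (26::nat)"
      using h by (intro inv_equality) (simp_all add: pow_order_eq_1)
    then show ?thesis
      using pow[OF that] by simp
  qed
  fix g assume "g \<in> generate G A"
  then show "g \<in> S"
    by induction (use S mult inv in auto)
qed

lemma carrier_word: "carrier G = (\<lambda>(i, j). word i j) ` ({..<9} \<times> {..<3})" (is "_ = ?W")
proof
  have "generate G {\<sigma>, \<tau>} \<subseteq> ?W"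
  proof (rule generate_subset)
    have W: "word (i mod 9) (j mod 3) \<in> ?W" for i j by force
    show "\<one> \<in> ?W" "{\<sigma>, \<tau>} \<subseteq> ?W"
      using W[of 0 0] W[of 1 0] W[of 0 1] by (simp_all add: word_0_0 word_sigma word_tau del: One_nat_def)
    show "g \<otimes> h \<in> ?W" if "g \<in> ?W" "h \<in> ?W" for g h
      using that W by (auto simp: word_mult)
  qed auto
  then show "carrier G \<subseteq> ?W"
    by (simp add: generated)
qed auto

text \<open>By counting: the 27 reduced words exhaust a group of order 27, so no two of them
  coincide.\<close>

lemma word_inject: "\<lbrakk>i < 9; k < 9; j < 3; l < 3\<rbrakk> \<Longrightarrow> word i j = word k l \<longleftrightarrow> i = k \<and> j = l"
proof -
  assume "i < 9" "k < 9" "j < 3" "l < 3"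
  moreover have "inj_on (\<lambda>(i, j). word i j) ({..<9} \<times> {..<3})"
    using order_27 by (intro eq_card_imp_inj_on) (simp_all add: order_def carrier_word)
  ultimately show ?thesis
    by (auto dest: inj_onD[where x = "(i, j)" and y = "(k, l)"])
qed

lemma subgroup_U_word: "subgroup_U G \<sigma> \<tau> = (\<lambda>(p, q). word (3 * p) q) ` ({..<3} \<times> {..<3})"
  (is "_ = ?U")
proof
  interpret H: subgroup "subgroup_U G \<sigma> \<tau>" G
    unfolding subgroup_U_def using sigma_closed tau_closed by (intro generate_is_subgroup) auto
  show "subgroup_U G \<sigma> \<tau> \<subseteq> ?U"
    unfolding subgroup_U_def
  proof (rule generate_subset)
    show "\<one> \<in> ?U" by (rule image_eqI[of _ _ "(0, 0)"]) (simp_all add: word_0_0)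
    have "word (3 * p) q \<in> ?U" if "p < 3" "q < 3" for p q using that by force
    from this[of 1 0] this[of 0 1] show "{\<sigma> [^] (3::nat), \<tau>} \<subseteq> ?U"
      by (simp add: sigma_pow_word word_tau del: One_nat_def)
    fix g h assume "g \<in> ?U" "h \<in> ?U"
    then obtain p q p' q' where gh: "g = word (3 * p) q" "h = word (3 * p') q'" by auto
    \<comment> \<open>Reduction modulo 9 of a multiple of 3 is reduction of the cofactor modulo 3,
      so the product is again an indexed element.\<close>
    have "(3 * p + 4 ^ q * (3 * p')) mod 9 = 3 * ((p + 4 ^ q * p') mod 3)"
      by (simp add: mult_mod_right algebra_simps)
    then have "g \<otimes> h = word (3 * ((p + 4 ^ q * p') mod 3)) ((q + q') mod 3)"
      unfolding gh word_mult by (simp only:)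
    then show "g \<otimes> h \<in> ?U" by force
  qed auto
  have pow: "h [^] n \<in> subgroup_U G \<sigma> \<tau>" if "h \<in> subgroup_U G \<sigma> \<tau>" for h and n :: nat
    using that by (induction n) auto
  have "\<sigma> [^] (3::nat) \<in> subgroup_U G \<sigma> \<tau>" "\<tau> \<in> subgroup_U G \<sigma> \<tau>"
    by (auto simp: subgroup_U_def intro: generate.incl)
  from this[THEN pow] show "?U \<subseteq> subgroup_U G \<sigma> \<tau>"
    using sigma_closed by (auto simp: word_def nat_pow_pow)
qed

lemma subgroup_H'_pow: "subgroup_H' G \<sigma> \<tau> = (\<lambda>k. (\<sigma> \<otimes> \<tau>) [^] k) ` {..<9::nat}" (is "_ = ?H")
proof
  note c = sigma_tau_closed
  interpret H: subgroup "subgroup_H' G \<sigma> \<tau>" G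
    unfolding subgroup_H'_def using c by (intro generate_is_subgroup) auto
  show "subgroup_H' G \<sigma> \<tau> \<subseteq> ?H"
    unfolding subgroup_H'_def
  proof (rule generate_subset)
    show "\<one> \<in> ?H" by (rule image_eqI[of _ _ 0]) auto
    show "{\<sigma> \<otimes> \<tau>} \<subseteq> ?H" by (rule insert_subsetI, rule image_eqI[of _ _ 1]) (use c in auto)
    fix g h assume "g \<in> ?H" "h \<in> ?H"
    then obtain k l :: nat where "g = (\<sigma> \<otimes> \<tau>) [^] k" "h = (\<sigma> \<otimes> \<tau>) [^] l" by auto
    then have "g \<otimes> h = (\<sigma> \<otimes> \<tau>) [^] ((k + l) mod 9)"
      using c by (simp add: nat_pow_mult pow_mod sigma_tau_pow_word)
    then show "g \<otimes> h \<in> ?H" by force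
  qed (use c in auto)
  have "\<sigma> \<otimes> \<tau> \<in> subgroup_H' G \<sigma> \<tau>"
    by (auto simp: subgroup_H'_def intro: generate.incl)
  then have "(\<sigma> \<otimes> \<tau>) [^] n \<in> subgroup_H' G \<sigma> \<tau>" for n :: nat
    by (induction n) auto
  then show "?H \<subseteq> subgroup_H' G \<sigma> \<tau>" by auto
qed

text \<open>The polynomial for \<open>- \<Sum> b(u) u(x)\<close> over
  \<open>u = \<sigma>^(3p) \<tau>^q\<close>, where \<open>(p, q)\<close> is the index
  \<open>i\<close> and \<open>b(u)\<close> is expanded by the cocycle rule into translates of
  \<open>b(\<sigma>^3)\<close> and \<open>b(\<tau>)\<close>. It is built from the group alone,
  before any ring is given.\<close>

definition solution :: "('a \<times> letter) list \<Rightarrow>\<^sub>0 int" where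
  "solution = (\<Sum>i\<in>{..<3} \<times> {..<3}.
    (\<Sum>k<fst i. Poly_Mapping.single
      [(word (3 * k) 0, Letter_b_sigma3), (word (3 * fst i) (snd i), Letter_x)] (- 1)) +
    (\<Sum>k<snd i. Poly_Mapping.single
      [(word (3 * fst i) k, Letter_b_tau), (word (3 * fst i) (snd i), Letter_x)] (- 1)))"

lemma nc_variables_solution: "nc_variables solution \<subseteq> subgroup_U G \<sigma> \<tau> \<times> UNIV"
proof -
  have U: "word (3 * p) q \<in> subgroup_U G \<sigma> \<tau>" if "p < 3" "q < 3" for p q
    using that by (auto simp: subgroup_U_word)
  show ?thesis
    unfolding solution_def
    by (intro subset_trans[OF nc_variables_sum] UN_least subset_trans[OF nc_variables_add] Un_least
        subset_trans[OF nc_variables_single]) (auto intro!: U)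
qed

end

text \<open>Keeps exponents as numerals, so that equal translates carry syntactically equal
  indices.\<close>

declare One_nat_def [simp del] One_nat_def [symmetric, simp]
  add_2_eq_Suc [simp del] add_2_eq_Suc' [simp del]

section \<open>Translates of ring elements by normal forms\<close>

locale G27_action = G27 G \<sigma> \<tau> + ring_action G R \<phi>
  for G :: "('g, 'm) monoid_scheme" and \<sigma> \<tau> and R :: "('r, 'n) ring_scheme" (structure) and \<phi>
begin

text \<open>With \<open>act_act\<close> as a rewrite rule, every iterated translate collapses to one
  with reduced exponents, and identities in the group ring become comparisons of sorted
  sums.\<close>

definition act :: "nat \<Rightarrow> nat \<Rightarrow> 'r \<Rightarrow> 'r" where
  "act i j = \<phi> (word i j)"

lemma act_closed [simp]: "r \<in> carrier R \<Longrightarrow> act i j r \<in> carrier R"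
  by (simp add: act_def)

lemma act_add [simp]:
  "\<lbrakk>r \<in> carrier R; s \<in> carrier R\<rbrakk> \<Longrightarrow> act i j (r \<oplus> s) = act i j r \<oplus> act i j s"
  by (simp add: act_def action_add)

lemma act_a_inv [simp]: "r \<in> carrier R \<Longrightarrow> act i j (\<ominus> r) = \<ominus> act i j r"
  by (simp add: act_def action_a_inv)

lemma act_minus [simp]:
  "\<lbrakk>r \<in> carrier R; s \<in> carrier R\<rbrakk> \<Longrightarrow> act i j (r \<ominus> s) = act i j r \<ominus> act i j s"
  by (simp add: minus_eq)

lemma act_mult:
  "\<lbrakk>r \<in> carrier R; s \<in> carrier R\<rbrakk> \<Longrightarrow> act i j (r \<otimes> s) = act i j r \<otimes> act i j s"
  by (simp add: act_def action_mult)

lemma act_one [simp]: "act i j \<one> = \<one>"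
  by (simp add: act_def action_ring_one)

lemma act_zero [simp]: "act i j \<zero> = \<zero>"
  using act_minus[of \<zero> \<zero> i j] by (simp add: minus_eq r_neg)

lemma act_act [simp]:
  "r \<in> carrier R \<Longrightarrow> act i j (act k l r) = act ((i + 4 ^ j * k) mod 9) ((j + l) mod 3) r"
  by (simp add: act_def action_comp word_mult)

lemma act_0_0 [simp]: "r \<in> carrier R \<Longrightarrow> act 0 0 r = r"
  by (simp add: act_def word_0_0 action_one)

lemma act_words:
  "\<phi> \<sigma> = act 1 0" "\<phi> \<tau> = act 0 1"
  "\<phi> (\<sigma> [^]\<^bsub>G\<^esub> n) = act n 0" "\<phi> (\<tau> [^]\<^bsub>G\<^esub> n) = act 0 n"
  "\<phi> (\<sigma> \<otimes>\<^bsub>G\<^esub> \<tau>) = act 1 1" "\<phi> ((\<sigma> \<otimes>\<^bsub>G\<^esub> \<tau>) [^]\<^bsub>G\<^esub> (2::nat)) = act 5 2"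
  by (simp_all only: act_def word_sigma word_tau sigma_pow_word tau_pow_word sigma_tau_pow_word
      sigma_tau_word[symmetric])

lemma three_by_three:
  "{..<3} \<times> {..<3} = {(0,0), (0,1), (0,2), (1,0), (1,1), (1,2), (2,0), (2,1), (2::nat,2::nat)}"
  by (auto simp: lessThan_nat_numeral lessThan_Suc)

section \<open>Norms over \<open>U\<close>, \<open>H'\<close> and \<open>G\<close>, and invariance
  under \<open>U\<close>\<close>

lemma action_norm_U:
  assumes "r \<in> carrier R"
  shows "action_norm R \<phi> (subgroup_U G \<sigma> \<tau>) r = (\<Oplus>i\<in>{..<3} \<times> {..<3}. act (3 * fst i) (snd i) r)"
proof -
  have "inj_on (\<lambda>(p, q). word (3 * p) q) ({..<3} \<times> {..<3})"
    by (auto simp: inj_on_def word_inject)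
  then show ?thesis
    using assms unfolding action_norm_def subgroup_U_word
    by (subst finsum_reindex) (auto simp: act_def split_def)
qed

lemma action_norm_U_words:
  assumes "r \<in> carrier R"
  shows "action_norm R \<phi> (subgroup_U G \<sigma> \<tau>) r
    = r \<oplus> act 0 1 r \<oplus> act 0 2 r \<oplus> act 3 0 r \<oplus> act 3 1 r \<oplus> act 3 2 r \<oplus> act 6 0 r \<oplus> act 6 1 r \<oplus> act 6 2 r"
  using assms by (simp add: action_norm_U three_by_three a_assoc)

lemma action_norm_H':
  assumes "r \<in> carrier R"
  shows "action_norm R \<phi> (subgroup_H' G \<sigma> \<tau>) r
    = (\<Oplus>k\<in>{..<9::nat}. \<phi> ((\<sigma> \<otimes>\<^bsub>G\<^esub> \<tau>) [^]\<^bsub>G\<^esub> k) r)"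
proof -
  have range9: "set [0, 1, 2, 3, 4, 5, 6, 7, 8] = {..<9::nat}" by auto
  \<comment> \<open>Injectivity on nine exponents is read off from the distinctness of the nine
    normal forms.\<close>
  have "map (\<lambda>k. (\<sigma> \<otimes>\<^bsub>G\<^esub> \<tau>) [^]\<^bsub>G\<^esub> k) [0, 1, 2, 3, 4, 5, 6, 7, 8::nat]
      = [word 0 0, word 1 1, word 5 2, word 3 0, word 4 1, word 8 2, word 6 0, word 7 1, word 2 2]"
    by (simp add: sigma_tau_pow_word word_0_0 sigma_tau_closed flip: sigma_tau_word)
  also have "distinct \<dots>"
    by (simp add: word_inject)
  finally have "inj_on (\<lambda>k. (\<sigma> \<otimes>\<^bsub>G\<^esub> \<tau>) [^]\<^bsub>G\<^esub> k) {..<9::nat}"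
    by (simp only: distinct_map range9)
  then show ?thesis
    using assms unfolding action_norm_def subgroup_H'_pow
    by (subst finsum_reindex) (auto simp: sigma_tau_closed)
qed

lemma action_norm_H'_words:
  assumes "r \<in> carrier R"
  shows "action_norm R \<phi> (subgroup_H' G \<sigma> \<tau>) r
    = r \<oplus> act 1 1 r \<oplus> act 5 2 r \<oplus> act 3 0 r \<oplus> act 4 1 r \<oplus> act 8 2 r \<oplus> act 6 0 r \<oplus> act 7 1 r \<oplus> act 2 2 r"
proof -
  have "{..<9} = {0, 1, 2, 3, 4, 5, 6, 7, 8::nat}" by auto
  with assms show ?thesis
    by (simp add: action_norm_H' act_def action_one sigma_tau_pow_word sigma_tau_closed a_assoc
      flip: sigma_tau_word)
qed

lemma fixed_U_iff:
  assumes r: "r \<in> carrier R"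
  shows "r \<in> fixed_elements R \<phi> (subgroup_U G \<sigma> \<tau>) \<longleftrightarrow> act 3 0 r = r \<and> act 0 1 r = r"
proof
  assume *: "act 3 0 r = r \<and> act 0 1 r = r"
  \<comment> \<open>Each translate by \<open>U\<close> is unfolded into steps by the two generators.
    This runs against \<open>act_act\<close>, which is therefore switched off below.\<close>
  have 1: "act 3 1 r = act 3 0 (act 0 1 r)" "act 6 1 r = act 3 0 (act 3 0 (act 0 1 r))"
    "act 0 2 r = act 0 1 (act 0 1 r)" "act 3 2 r = act 3 0 (act 0 1 (act 0 1 r))"
    "act 6 2 r = act 3 0 (act 3 0 (act 0 1 (act 0 1 r)))" "act 6 0 r = act 3 0 (act 3 0 r)"
    using r by simp_all
  have "act (3 * p) q r = r" if "p < 3" "q < 3" for p q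
  proof -
    have "p = 0 \<or> p = 1 \<or> p = 2" "q = 0 \<or> q = 1 \<or> q = 2" using that by auto
    then show ?thesis using * 1 r by (auto simp del: act_act simp: mult_2)
  qed
  then show "r \<in> fixed_elements R \<phi> (subgroup_U G \<sigma> \<tau>)"
    using r by (auto simp: fixed_elements_def subgroup_U_word act_def)
next
  assume "r \<in> fixed_elements R \<phi> (subgroup_U G \<sigma> \<tau>)"
  then have "\<forall>p<3. \<forall>q<3. act (3 * p) q r = r"
    by (auto simp: fixed_elements_def subgroup_U_word act_def)
  from this[THEN spec, of 1] this[THEN spec, of 0] show "act 3 0 r = r \<and> act 0 1 r = r"
    by auto
qed

text \<open>Normality of \<open>U\<close> in action: \<open>\<sigma>^3\<close> commutes with
  \<sigma>, and \<open>\<tau> \<sigma> = \<sigma> (\<sigma>^3 \<tau>)\<close>.\<close>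

lemma fixed_U_sigma:
  assumes r: "r \<in> carrier R" "r \<in> fixed_elements R \<phi> (subgroup_U G \<sigma> \<tau>)"
  shows "act 1 0 r \<in> fixed_elements R \<phi> (subgroup_U G \<sigma> \<tau>)"
proof -
  have "act 3 0 r = r" "act 0 1 r = r" using r by (simp_all add: fixed_U_iff)
  moreover have "act 3 0 (act 1 0 r) = act 1 0 (act 3 0 r)"
    "act 0 1 (act 1 0 r) = act 1 0 (act 3 0 (act 0 1 r))"
    using r by simp_all
  ultimately show ?thesis using r by (simp add: fixed_U_iff del: act_act)
qed

text \<open>Transitivity of the norm: \<open>G\<close> is the disjoint union of \<open>U\<close>,
  \<open>\<sigma> U\<close> and \<open>\<sigma>^2 U\<close>.\<close>

lemma action_norm_carrier:
  assumes r: "r \<in> carrier R"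
  defines "s \<equiv> action_norm R \<phi> (subgroup_U G \<sigma> \<tau>) r"
  shows "action_norm R \<phi> (carrier G) r = s \<oplus> act 1 0 s \<oplus> act 2 0 s"
proof -
  have range: "{..<3} = {0, 1, 2::nat}" "{..<9} = {0, 1, 2, 3, 4, 5, 6, 7, 8::nat}" by auto
  have "inj_on (\<lambda>(i, j). word i j) ({..<9} \<times> {..<3})"
    by (auto simp: inj_on_def word_inject)
  then have "action_norm R \<phi> (carrier G) r = (\<Oplus>i\<in>{..<9} \<times> {..<3}. act (fst i) (snd i) r)"
    using r unfolding action_norm_def carrier_word
    by (subst finsum_reindex) (auto simp: act_def split_def)
  also have "\<dots> = (\<Oplus>i\<in>{..<9}. \<Oplus>j\<in>{..<3}. act i j r)"
    using r by (simp add: finsum_Times)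
  finally show ?thesis
    using r unfolding s_def range by (simp add: action_norm_U_words a_ac)
qed

section \<open>The quotient \<open>G/U\<close> and its norm\<close>

lemma cosets_U:
  "carrier (G Mod subgroup_U G \<sigma> \<tau>) = (\<lambda>i. subgroup_U G \<sigma> \<tau> #>\<^bsub>G\<^esub> word i 0) ` {..<3}" (is "_ = ?C ` _")
  "inj_on (\<lambda>i. subgroup_U G \<sigma> \<tau> #>\<^bsub>G\<^esub> word i 0) {..<3}"
proof -
  let ?U = "subgroup_U G \<sigma> \<tau>"
  have sub: "subgroup ?U G"
    unfolding subgroup_U_def using sigma_closed tau_closed by (intro generate_is_subgroup) auto
  have U: "?U = {word 0 0, word 0 1, word 0 2, word 3 0, word 3 1, word 3 2, word 6 0, word 6 1, word 6 2}"
    unfolding subgroup_U_word three_by_three by simp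
  have mem: "word i 0 \<in> ?C i" for i
    using rcos_self[OF _ sub] by simp
  show inj: "inj_on ?C {..<3}"
  proof (rule inj_onI)
    fix i k :: nat assume i: "i \<in> {..<3}" and k: "k \<in> {..<3}" and eq: "?C i = ?C k"
    have "i = 0 \<or> i = 1 \<or> i = 2" "k = 0 \<or> k = 1 \<or> k = 2" using i k by auto
    moreover have "word i 0 \<in> ?C k" using mem[of i] by (simp only: eq)
    ultimately show "i = k"
      by (auto simp: U r_coset_def word_mult word_inject)
  qed
  \<comment> \<open>Lagrange gives exactly three cosets, so the three distinct ones found above are
    all of them.\<close>
  have "card ?U = 9"
    unfolding U by (simp add: word_inject)
  then have "card (rcosets\<^bsub>G\<^esub> ?U) = 3"
    using lagrange[OF sub] order_27 by simp
  moreover have "card (?C ` {..<3}) = 3"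
    using inj by (simp add: card_image)
  moreover have "?C ` {..<3} \<subseteq> rcosets\<^bsub>G\<^esub> ?U"
    unfolding RCOSETS_def by (blast intro: word_closed)
  ultimately have "?C ` {..<3} = rcosets\<^bsub>G\<^esub> ?U"
    by (intro card_subset_eq) (auto intro: card_ge_0_finite)
  then show "carrier (G Mod ?U) = ?C ` {..<3}"
    by (simp add: FactGroup_def)
qed

text \<open>A representative of this right coset is \<open>u \<sigma>^i\<close> with
  \<open>u\<close> in \<open>U\<close>, and it sends \<open>r\<close> to
  \<open>u(\<sigma>^i(r))\<close>; hence the invariance is asked of
  \<open>act i 0 r\<close>.\<close>

lemma coset_action_U:
  assumes r: "r \<in> carrier R" "act i 0 r \<in> fixed_elements R \<phi> (subgroup_U G \<sigma> \<tau>)"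
  shows "coset_action \<phi> (subgroup_U G \<sigma> \<tau> #>\<^bsub>G\<^esub> word i 0) r = act i 0 r"
proof -
  have "(\<lambda>g. \<phi> g r) ` (subgroup_U G \<sigma> \<tau> #>\<^bsub>G\<^esub> word i 0)
    = (\<lambda>u. \<phi> u (act i 0 r)) ` subgroup_U G \<sigma> \<tau>"
  proof -
    have "subgroup_U G \<sigma> \<tau> #>\<^bsub>G\<^esub> word i 0 = (\<lambda>u. u \<otimes>\<^bsub>G\<^esub> word i 0) ` subgroup_U G \<sigma> \<tau>"
      by (auto simp: r_coset_def)
    moreover have "subgroup_U G \<sigma> \<tau> \<subseteq> carrier G" by (auto simp: subgroup_U_word)
    ultimately show ?thesis
      using r(1) by (auto simp: image_image act_def action_comp subset_iff intro!: image_cong)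
  qed
  also have "\<dots> = {act i 0 r}"
    \<comment> \<open>The witness 0 makes the index range nonempty, so the image is a singleton and
      not empty.\<close>
    using r(2) exI[of "\<lambda>p. p < 3" "0::nat"] by (auto simp: fixed_elements_def subgroup_U_word image_iff)
  finally show ?thesis by (simp add: coset_action_def)
qed

lemma action_norm_quotient:
  assumes r: "r \<in> carrier R" "r \<in> fixed_elements R \<phi> (subgroup_U G \<sigma> \<tau>)"
  shows "action_norm R (coset_action \<phi>) (carrier (G Mod subgroup_U G \<sigma> \<tau>)) r
    = r \<oplus> act 1 0 r \<oplus> act 2 0 r"
proof -
  let ?F = "fixed_elements R \<phi> (subgroup_U G \<sigma> \<tau>)"
  have 1: "act 1 0 r \<in> ?F" using r by (rule fixed_U_sigma)
  have 2: "act 2 0 r \<in> ?F" using fixed_U_sigma[OF _ 1] r(1) by simp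
  have fixed: "act i 0 r \<in> ?F" if "i < 3" for i
  proof -
    have "i = 0 \<or> i = 1 \<or> i = 2" using that by auto
    then show ?thesis using r 1 2 by auto
  qed
  have "action_norm R (coset_action \<phi>) (carrier (G Mod subgroup_U G \<sigma> \<tau>)) r
      = (\<Oplus>i\<in>{..<3}. act i 0 r)"
    unfolding action_norm_def cosets_U(1) using cosets_U(2) r
    by (subst finsum_reindex) (auto simp: coset_action_U fixed intro!: finsum_cong')
  also have "{..<3} = {0, 1, 2::nat}" by auto
  finally show ?thesis using r by (simp add: a_assoc)
qed

end

section \<open>The cocycle of a norm one element\<close>

locale G27_norm_one = G27_action +
  fixes x
  assumes x [simp]: "x \<in> carrier R"
    and norm_U: "action_norm R \<phi> (subgroup_U G \<sigma> \<tau>) x = \<one>"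
begin

section \<open>The orbit of \<open>x\<^sub>0\<close> under \<rho> and the norm of
  \<open>x'\<close>\<close>

abbreviation x\<^sub>0 where "x\<^sub>0 \<equiv> x_zero G R \<phi> \<tau> x"
abbreviation x' where "x' \<equiv> x_prime G R \<phi> \<sigma> \<tau> x"

lemma x_zero_eq: "x\<^sub>0 = x \<oplus> act 0 1 x \<oplus> act 0 2 x"
  by (simp add: x_zero_def act_words)

lemma x_zero_closed: "x\<^sub>0 \<in> carrier R"
  by (simp add: x_zero_eq)

text \<open>The nine terms of the norm of \<open>x\<close> over \<open>U\<close>, grouped by powers
  of \<open>\<sigma>^3\<close>.\<close>

lemma x_zero_trace: "x\<^sub>0 \<oplus> act 3 0 x\<^sub>0 \<oplus> act 6 0 x\<^sub>0 = \<one>"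
  using norm_U by (simp add: action_norm_U three_by_three x_zero_eq a_ac)

definition orbit :: "nat \<Rightarrow> 'c" where
  "orbit k = \<phi> ((\<sigma> \<otimes>\<^bsub>G\<^esub> \<tau>) [^]\<^bsub>G\<^esub> k) x\<^sub>0"

lemma orbit_closed [simp]: "orbit k \<in> carrier R"
  by (simp add: orbit_def sigma_tau_closed x_zero_closed)

lemma sigma_tau_orbit: "\<phi> ((\<sigma> \<otimes>\<^bsub>G\<^esub> \<tau>) [^]\<^bsub>G\<^esub> k) (orbit m) = orbit (k + m)"
  by (simp add: orbit_def action_comp sigma_tau_closed x_zero_closed sigma_tau_pow_add)

text \<open>Because \<open>\<rho>^3 = \<sigma>^3\<close>, the case \<open>k = 0\<close> is
  \<open>x_zero_trace\<close>; the others are its translates by powers of \<rho>.\<close>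

lemma orbit_trace: "orbit k \<oplus> orbit (k + 3) \<oplus> orbit (k + 6) = \<one>"
proof -
  have "orbit 0 \<oplus> orbit 3 \<oplus> orbit 6 = \<one>"
    using x_zero_trace by (simp add: orbit_def sigma_tau_pow_word act_def action_one x_zero_closed)
  then have "\<phi> ((\<sigma> \<otimes>\<^bsub>G\<^esub> \<tau>) [^]\<^bsub>G\<^esub> k) (orbit 0 \<oplus> orbit 3 \<oplus> orbit 6) = \<one>"
    by (simp add: action_ring_one sigma_tau_closed)
  then show ?thesis
    by (simp add: action_add sigma_tau_orbit sigma_tau_closed)
qed

lemma orbit_period: "orbit (k + 9) = orbit k"
  using sigma_tau_orbit[of k 9] by (simp add: orbit_def sigma_tau_pow_word action_one x_zero_closed)

text \<open>\<open>potential k\<close> and \<open>multiplier k\<close> are the translates by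
  \<open>\<rho>^k\<close> of \<open>q_0\<close> and \<open>l_0\<close>, written out in the shape
  that \<open>norm_one_element\<close> expects.\<close>

definition potential :: "nat \<Rightarrow> 'c" where
  "potential k = orbit k \<otimes> (orbit (k+3) \<oplus> orbit (k+4) \<oplus> orbit (k+5) \<oplus> orbit (k+6) \<oplus> orbit (k+7) \<oplus> orbit (k+8))
      \<ominus> orbit k \<ominus> orbit (k+3) \<oplus> orbit (k+3) \<otimes> (orbit (k+6) \<oplus> orbit (k+7) \<oplus> orbit (k+8))"

definition multiplier :: "nat \<Rightarrow> 'c" where
  "multiplier k = orbit (k+1) \<oplus> (potential k \<ominus> potential (k+1))"

lemma potential_closed [simp]: "potential k \<in> carrier R"
  and multiplier_closed [simp]: "multiplier k \<in> carrier R"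
  by (simp_all add: potential_def multiplier_def)

lemma sigma_tau_multiplier: "\<phi> ((\<sigma> \<otimes>\<^bsub>G\<^esub> \<tau>) [^]\<^bsub>G\<^esub> k) (multiplier 0) = multiplier k"
  by (simp add: multiplier_def potential_def minus_eq action_add action_mult action_a_inv sigma_tau_orbit sigma_tau_closed
      add.assoc)

lemma x_prime_eq: "x' = multiplier 0 \<otimes> orbit 0"
proof -
  \<comment> \<open>Here \<open>a_j\<close> is \<open>orbit j\<close>. The last \<open>a0\<close> in
    each bracket coming from \<open>potential 1\<close> is \<open>orbit 9\<close>, identified with
    \<open>orbit 0\<close> by periodicity. Every term of \<open>x'\<close> ends in
    \<open>a0\<close>, which gives the right factor.\<close>
  have id: "\<ominus> (a0 \<otimes> a0) \<oplus> (a1 \<otimes> a0 \<oplus> a1 \<otimes> a0) \<ominus> a3 \<otimes> a0 \<oplus> a4 \<otimes> a0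
     \<oplus> (a0 \<otimes> a3 \<otimes> a0 \<oplus> (a0 \<otimes> a4 \<otimes> a0 \<oplus> (a0 \<otimes> a5 \<otimes> a0
       \<oplus> (a0 \<otimes> a6 \<otimes> a0 \<oplus> (a0 \<otimes> a7 \<otimes> a0 \<oplus> a0 \<otimes> a8 \<otimes> a0)))))
     \<ominus> (a1 \<otimes> a4 \<otimes> a0 \<oplus> (a1 \<otimes> a5 \<otimes> a0 \<oplus> (a1 \<otimes> a6 \<otimes> a0 \<oplus> (a1 \<otimes> a7 \<otimes> a0 \<oplus> a1 \<otimes> a8 \<otimes> a0))))
     \<ominus> a1 \<otimes> (a0 \<otimes> a0)
     \<oplus> (a3 \<otimes> a6 \<otimes> a0 \<oplus> (a3 \<otimes> a7 \<otimes> a0 \<oplus> a3 \<otimes> a8 \<otimes> a0))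
     \<ominus> a4 \<otimes> a7 \<otimes> a0 \<ominus> a4 \<otimes> a8 \<otimes> a0 \<ominus> a4 \<otimes> (a0 \<otimes> a0)
   = (a1 \<oplus> ((a0 \<otimes> (a3 \<oplus> a4 \<oplus> a5 \<oplus> a6 \<oplus> a7 \<oplus> a8) \<ominus> a0 \<ominus> a3 \<oplus> a3 \<otimes> (a6 \<oplus> a7 \<oplus> a8))
      \<ominus> (a1 \<otimes> (a4 \<oplus> a5 \<oplus> a6 \<oplus> a7 \<oplus> a8 \<oplus> a0) \<ominus> a1 \<ominus> a4 \<oplus> a4 \<otimes> (a7 \<oplus> a8 \<oplus> a0)))) \<otimes> a0"
    if "a0 \<in> carrier R" "a1 \<in> carrier R" "a3 \<in> carrier R" "a4 \<in> carrier R" "a5 \<in> carrier R"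
      "a6 \<in> carrier R" "a7 \<in> carrier R" "a8 \<in> carrier R" for a0 a1 a3 a4 a5 a6 a7 a8
    using that by (simp add: ring_expand)
  have range: "{3..8} = {3, 4, 5, 6, 7, 8::nat}" "{4..8} = {4, 5, 6, 7, 8::nat}"
    "{6..8} = {6, 7, 8::nat}"
    by auto
  have y0: "x\<^sub>0 = orbit 0" by (simp add: orbit_def action_one x_zero_closed)
  have y9: "orbit 9 = orbit 0" using orbit_period[of 0] by simp
  show ?thesis
    unfolding x_prime_def Let_def orbit_def[symmetric] multiplier_def potential_def
    by (simp add: y0 y9 range add_pow_2 nat_pow_2 id[symmetric])
qed

lemma x_prime_closed [simp]: "x' \<in> carrier R"
  by (simp add: x_prime_eq)

lemma norm_H': "action_norm R \<phi> (subgroup_H' G \<sigma> \<tau>) x' = \<one>"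
proof -
  have "action_norm R \<phi> (subgroup_H' G \<sigma> \<tau>) x'
      = (\<Oplus>k\<in>{..<9::nat}. \<phi> ((\<sigma> \<otimes>\<^bsub>G\<^esub> \<tau>) [^]\<^bsub>G\<^esub> k) (multiplier 0 \<otimes> orbit 0))"
    using action_norm_H' x_prime_closed unfolding x_prime_eq .
  also have "\<dots> = (\<Oplus>k\<in>{..<9}. multiplier k \<otimes> orbit k)"
    by (simp add: action_mult sigma_tau_multiplier sigma_tau_orbit sigma_tau_closed)
  also have "\<dots> = \<one>"
    using norm_one_element[of orbit, OF orbit_closed orbit_trace orbit_period] unfolding multiplier_def potential_def .
  finally show ?thesis .
qed

section \<open>The values of \<open>b\<close> and the relators of \<open>G\<close>\<close>

abbreviation "bs \<equiv> b_sigma G R \<phi> \<sigma> \<tau> x"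
abbreviation "bt \<equiv> b_tau G R \<phi> \<sigma> \<tau> x"
abbreviation "bs3 \<equiv> b_sigma3 G R \<phi> \<sigma> \<tau> x"

lemma b_sigma_eq: "bs = x' \<oplus> act 1 1 x' \<oplus> act 5 2 x'"
  by (simp add: b_sigma_def Let_def act_words)

lemma b_sigma_closed [simp]: "bs \<in> carrier R"
  by (simp add: b_sigma_eq)

text \<open>
  Subtraction is avoided in the following identities: splitting the bracket in \<open>b(\<tau>)\<close> into a
  positive and a negative part leaves equalities of sums, which sorting decides.
\<close>

definition v_pos :: 'c where "v_pos = act 6 0 x'"

definition v_neg :: 'c where "v_neg = act 1 1 x' \<oplus> act 2 1 x' \<oplus> act 3 1 x' \<oplus> act 5 1 x'"

lemma v_closed [simp]: "v_pos \<in> carrier R" "v_neg \<in> carrier R"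
  by (simp_all add: v_pos_def v_neg_def)

lemma b_tau_eq: "bt = act 0 1 (v_pos \<ominus> v_neg) \<ominus> (v_pos \<ominus> v_neg)"
  by (simp add: b_tau_def Let_def act_words v_pos_def v_neg_def)

lemma b_tau_diff: "bt = (act 0 1 v_pos \<oplus> v_neg) \<ominus> (v_pos \<oplus> act 0 1 v_neg)"
  by (simp add: b_tau_eq ring_expand)

lemma b_tau_closed [simp]: "bt \<in> carrier R"
  by (simp add: b_tau_eq)

lemma b_sigma3_eq: "bs3 = bs \<oplus> act 1 0 bs \<oplus> act 2 0 bs \<ominus> \<one>"
  by (simp add: b_sigma3_def act_words)

lemma b_sigma3_closed [simp]: "bs3 \<in> carrier R"
  by (simp add: b_sigma3_eq)

lemma trace_x_prime:
  "x' \<oplus> act 1 1 x' \<oplus> act 5 2 x' \<oplus> act 3 0 x' \<oplus> act 4 1 x' \<oplus> act 8 2 x'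
    \<oplus> act 6 0 x' \<oplus> act 7 1 x' \<oplus> act 2 2 x' = \<one>"
  using norm_H' by (simp add: action_norm_H'_words)

text \<open>As \<open>b(\<sigma>) = (1 + \<rho> + \<rho>^2)(x')\<close> and
  \<open>\<rho>^3 = \<sigma>^3\<close>, the left side is the norm of \<open>x'\<close> over
  \<open>H'\<close>.\<close>

lemma trace_b_sigma: "bs \<oplus> act 3 0 bs \<oplus> act 6 0 bs = \<one>"
  using trace_x_prime by (simp add: b_sigma_eq a_assoc)

text \<open>The cocycle condition for the relator \<open>(\<sigma>^3)^3\<close>. The nine translates
  of \<open>b(\<sigma>)\<close> form three copies of \<open>trace_b_sigma\<close>, which cancel the
  three subtracted ones.\<close>

lemma trace_b_sigma3: "bs3 \<oplus> act 3 0 bs3 \<oplus> act 6 0 bs3 = \<zero>"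
proof -
  have "act i 0 (bs \<oplus> act 3 0 bs \<oplus> act 6 0 bs) = \<one>" for i
    by (simp add: trace_b_sigma del: act_add act_act)
  from this[of 1] this[of 2]
  have "act 1 0 bs \<oplus> act 4 0 bs \<oplus> act 7 0 bs = \<one>" "act 2 0 bs \<oplus> act 5 0 bs \<oplus> act 8 0 bs = \<one>"
    by simp_all
  moreover have "bs3 \<oplus> act 3 0 bs3 \<oplus> act 6 0 bs3 = (bs \<oplus> act 3 0 bs \<oplus> act 6 0 bs)
     \<oplus> (act 1 0 bs \<oplus> act 4 0 bs \<oplus> act 7 0 bs) \<oplus> (act 2 0 bs \<oplus> act 5 0 bs \<oplus> act 8 0 bs) \<ominus> \<one> \<ominus> \<one> \<ominus> \<one>"
    by (simp add: b_sigma3_eq ring_expand)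
  ultimately show ?thesis
    by (simp add: trace_b_sigma ring_expand)
qed

text \<open>The relator \<open>\<tau>^3\<close>: \<open>b(\<tau>)\<close> has the form
  \<open>(\<tau> - 1)(v)\<close>, and \<open>1 + \<tau> + \<tau>^2\<close> annihilates it.\<close>

lemma trace_b_tau: "bt \<oplus> act 0 1 bt \<oplus> act 0 2 bt = \<zero>"
proof -
  have "act 0 1 v \<ominus> v \<oplus> act 0 1 (act 0 1 v \<ominus> v) \<oplus> act 0 2 (act 0 1 v \<ominus> v) = \<zero>" if "v \<in> carrier R" for v
    using that by (simp add: ring_expand)
  from this[of "v_pos \<ominus> v_neg"] show ?thesis
    unfolding b_tau_eq by (simp del: act_minus act_act)
qed

text \<open>The relator \<open>\<tau> \<sigma>^3 = \<sigma>^3 \<tau>\<close>: the two cocycle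
  expansions of \<open>b\<close> at this element agree.\<close>

lemma compatibility: "act 0 1 bs3 \<ominus> bs3 = act 3 0 bt \<ominus> bt"
proof -
  have id: "(s \<ominus> \<one>) \<ominus> (t \<ominus> \<one>) = (p' \<ominus> n') \<ominus> (p \<ominus> n)"
    if e: "s \<oplus> p \<oplus> n' = t \<oplus> p' \<oplus> n"
      and c: "s \<in> carrier R" "t \<in> carrier R" "p \<in> carrier R" "n \<in> carrier R" "p' \<in> carrier R" "n' \<in> carrier R"
    for s t p n p' n'
  proof -
    have "(s \<ominus> \<one>) \<ominus> (t \<ominus> \<one>) = (s \<oplus> p \<oplus> n') \<ominus> (t \<oplus> p \<oplus> n')"
      using c by algebra
    also have "\<dots> = (p' \<ominus> n') \<ominus> (p \<ominus> n)"
      unfolding e using c by algebra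
    finally show ?thesis .
  qed
  \<comment> \<open>After expansion both sides are the same sum of translates of
    \<open>x'\<close>.\<close>
  have "act 0 1 (bs \<oplus> act 1 0 bs \<oplus> act 2 0 bs) \<oplus> (act 0 1 v_pos \<oplus> v_neg) \<oplus> act 3 0 (v_pos \<oplus> act 0 1 v_neg)
      = (bs \<oplus> act 1 0 bs \<oplus> act 2 0 bs) \<oplus> act 3 0 (act 0 1 v_pos \<oplus> v_neg) \<oplus> (v_pos \<oplus> act 0 1 v_neg)"
    by (simp add: b_sigma_eq v_pos_def v_neg_def a_ac)
  from id[OF this] show ?thesis
    by (simp add: b_sigma3_eq b_tau_diff)
qed

text \<open>The relator \<open>\<tau> \<sigma> = \<sigma>^4 \<tau>\<close>, with
  \<open>\<sigma>^4\<close> read as \<open>\<sigma> \<sigma>^3\<close> in expanding the right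
  side.\<close>

lemma cocycle_relation: "act 0 1 bs \<oplus> bt = bs \<oplus> act 1 0 bs3 \<oplus> act 4 0 bt"
proof -
  have id: "r \<oplus> (p \<ominus> n) = b \<oplus> (s \<ominus> \<one>) \<oplus> (p' \<ominus> n')"
    if e: "r \<oplus> p \<oplus> n' \<oplus> \<one> = b \<oplus> s \<oplus> p' \<oplus> n"
      and c: "r \<in> carrier R" "b \<in> carrier R" "s \<in> carrier R" "p \<in> carrier R" "n \<in> carrier R" "p' \<in> carrier R" "n' \<in> carrier R"
    for r b s p n p' n'
  proof -
    have "r \<oplus> (p \<ominus> n) = (r \<oplus> p \<oplus> n' \<oplus> \<one>) \<ominus> \<one> \<ominus> n' \<ominus> n"
      using c by algebra
    also have "\<dots> = b \<oplus> (s \<ominus> \<one>) \<oplus> (p' \<ominus> n')"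
      unfolding e using c by algebra
    finally show ?thesis .
  qed
  \<comment> \<open>The constant 1 inside \<open>b(\<sigma>^3)\<close> is represented by the
    nine-term norm of \<open>x'\<close>; with it the identity is again one between sums of
    translates.\<close>
  have "act 0 1 bs \<oplus> (act 0 1 v_pos \<oplus> v_neg) \<oplus> act 4 0 (v_pos \<oplus> act 0 1 v_neg)
      \<oplus> (x' \<oplus> act 1 1 x' \<oplus> act 5 2 x' \<oplus> act 3 0 x' \<oplus> act 4 1 x' \<oplus> act 8 2 x'
    \<oplus> act 6 0 x' \<oplus> act 7 1 x' \<oplus> act 2 2 x')
      = bs \<oplus> act 1 0 (bs \<oplus> act 1 0 bs \<oplus> act 2 0 bs) \<oplus> act 4 0 (act 0 1 v_pos \<oplus> v_neg) \<oplus> (v_pos \<oplus> act 0 1 v_neg)"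
    by (simp add: b_sigma_eq v_pos_def v_neg_def a_ac)
  then show ?thesis
    unfolding trace_x_prime
    using id[of "act 0 1 bs" "act 0 1 v_pos \<oplus> v_neg" "act 4 0 (v_pos \<oplus> act 0 1 v_neg)" bs
      "act 1 0 (bs \<oplus> act 1 0 bs \<oplus> act 2 0 bs)" "act 4 0 (act 0 1 v_pos \<oplus> v_neg)" "v_pos \<oplus> act 0 1 v_neg"]
    by (simp add: b_sigma3_eq b_tau_diff)
qed

section \<open>Splitting the cocycle on \<open>U\<close>\<close>

lemma letter_value_closed: "letter_value G R \<phi> \<sigma> \<tau> x \<in> carrier G \<times> UNIV \<rightarrow> carrier R"
  by (auto simp: letter_value_def split: letter.split)

text \<open>The value at \<open>(p, q)\<close> is \<open>-b(\<sigma>^(3p) \<tau>^q)\<close>, where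
  \<open>b\<close> is extended from the two generators of \<open>U\<close> by the cocycle
  rule.\<close>

definition cochain :: "nat \<times> nat \<Rightarrow> 'c" where
  "cochain i = (\<Oplus>k\<in>{..<fst i}. \<ominus> act (3 * k) 0 bs3) \<oplus> (\<Oplus>k\<in>{..<snd i}. \<ominus> act (3 * fst i) k bt)"

definition translate :: "nat \<times> nat \<Rightarrow> 'c" where
  "translate i = act (3 * fst i) (snd i) x"

lemma cochain_closed [simp]: "cochain i \<in> carrier R"
  and translate_closed [simp]: "translate i \<in> carrier R"
  by (auto simp: cochain_def translate_def intro!: finsum_closed)

lemma translate_sum: "(\<Oplus>i\<in>{..<3} \<times> {..<3}. translate i) = \<one>"
  using norm_U by (simp add: action_norm_U translate_def)

lemma small_ranges: "{..<0::nat} = {}" "{..<1} = {0::nat}" "{..<2} = {0, 1::nat}"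
  by auto

lemma b_sigma3_relation: "act 6 0 bs3 = \<ominus> bs3 \<ominus> act 3 0 bs3"
  using trace_b_sigma3 by (intro minus_solve) simp_all

lemma mod3_cancel:
  "n < 3 \<Longrightarrow> ((n + 1) mod 3 + 2) mod 3 = n" "n < 3 \<Longrightarrow> ((n + 2) mod 3 + 1) mod 3 = n" for n :: nat
  by presburger+

text \<open>Left multiplication by \<open>\<sigma>^3\<close> raises the first index cyclically. Only
  the wrap from 2 to 0 needs a relation, namely \<open>b_sigma3_relation\<close>.\<close>

lemma coboundary_sigma3:
  defines "w \<equiv> \<Oplus>i\<in>{..<3} \<times> {..<3}. cochain i \<otimes> translate i"
  shows "\<phi> (word 3 0) w \<ominus> w = bs3"
  unfolding w_def
proof (rule coboundary[where \<pi> = "\<lambda>i. ((fst i + 1) mod 3, snd i)"])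
  show "bij_betw (\<lambda>i. ((fst i + 1) mod 3, snd i)) ({..<3} \<times> {..<3::nat}) ({..<3::nat} \<times> {..<3})"
    by (rule bij_betw_byWitness[where f' = "\<lambda>i. ((fst i + 2) mod 3, snd i)"]) (auto simp: mod3_cancel)
  fix i :: "nat \<times> nat" assume i: "i \<in> {..<3} \<times> {..<3}"
  then have c: "fst i = 0 \<or> fst i = 1 \<or> fst i = 2" "snd i = 0 \<or> snd i = 1 \<or> snd i = 2"
    by auto
  show "\<phi> (word 3 0) (translate i) = translate ((fst i + 1) mod 3, snd i)"
    unfolding act_def[symmetric] using c by (auto simp: translate_def)
  show "\<phi> (word 3 0) (cochain i) = bs3 \<oplus> cochain ((fst i + 1) mod 3, snd i)"
    unfolding act_def[symmetric] using c
    by (elim disjE) (simp_all add: cochain_def small_ranges b_sigma3_relation ring_expand)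
qed (auto simp: translate_sum)

text \<open>Left multiplication by \<tau> raises the second index cyclically, past
  \<open>\<sigma>^(3p)\<close> since \<open>U\<close> is abelian. \<open>compatibility\<close>
  carries \<tau> through the translates of \<open>b(\<sigma>^3)\<close>, and
  \<open>trace_b_tau\<close> handles the wrap from 2 to 0.\<close>

lemma coboundary_tau:
  defines "w \<equiv> \<Oplus>i\<in>{..<3} \<times> {..<3}. cochain i \<otimes> translate i"
  shows "\<phi> (word 0 1) w \<ominus> w = bt"
  unfolding w_def
proof (rule coboundary[where \<pi> = "\<lambda>i. (fst i, (snd i + 1) mod 3)"])
  show "bij_betw (\<lambda>i. (fst i, (snd i + 1) mod 3)) ({..<3} \<times> {..<3::nat}) ({..<3::nat} \<times> {..<3})"
    by (rule bij_betw_byWitness[where f' = "\<lambda>i. (fst i, (snd i + 2) mod 3)"]) (auto simp: mod3_cancel)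
  have "act i 0 (bt \<oplus> act 0 1 bt \<oplus> act 0 2 bt) = \<zero>" for i
    by (simp add: trace_b_tau del: act_add act_act)
  from this[of 0] this[of 3] this[of 6]
  have "bt \<oplus> act 0 1 bt \<oplus> act 0 2 bt = \<zero>" "act 3 0 bt \<oplus> act 3 1 bt \<oplus> act 3 2 bt = \<zero>"
    "act 6 0 bt \<oplus> act 6 1 bt \<oplus> act 6 2 bt = \<zero>"
    by (simp_all only: act_add act_act act_closed b_tau_closed a_closed) simp_all
  then have bt2: "act 0 2 bt = \<ominus> bt \<ominus> act 0 1 bt" "act 3 2 bt = \<ominus> act 3 0 bt \<ominus> act 3 1 bt"
    "act 6 2 bt = \<ominus> act 6 0 bt \<ominus> act 6 1 bt"
    by (auto intro!: minus_solve)
  have bs: "act 0 1 bs3 = bs3 \<oplus> (act 3 0 bt \<ominus> bt)"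
    by (rule add_solve[OF compatibility]) simp_all
  have "act 3 0 (act 0 1 bs3) = act 3 0 (bs3 \<oplus> (act 3 0 bt \<ominus> bt))"
    by (simp only: bs)
  \<comment> \<open>Adding this to \<open>bs\<close> telescopes: over \<open>k < p\<close> the
    corrections sum to \<open>(\<sigma>^(3p) - 1) b(\<tau>)\<close>.\<close>
  then have bs': "act 3 1 bs3 = act 3 0 bs3 \<oplus> (act 6 0 bt \<ominus> act 3 0 bt)"
    by simp
  fix i :: "nat \<times> nat" assume i: "i \<in> {..<3} \<times> {..<3}"
  then have c: "fst i = 0 \<or> fst i = 1 \<or> fst i = 2" "snd i = 0 \<or> snd i = 1 \<or> snd i = 2"
    by auto
  show "\<phi> (word 0 1) (translate i) = translate (fst i, (snd i + 1) mod 3)"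
    unfolding act_def[symmetric] using c by (auto simp: translate_def)
  show "\<phi> (word 0 1) (cochain i) = bt \<oplus> cochain (fst i, (snd i + 1) mod 3)"
    unfolding act_def[symmetric] using c
    by (elim disjE) (simp_all add: cochain_def small_ranges bs bs' bt2 ring_expand,
      (use act_closed[OF b_tau_closed] act_closed[OF b_sigma3_closed] in algebra)+)
qed (auto simp: translate_sum)

text \<open>All monomials of index \<open>i\<close> end in the same letter, the translate of
  \<open>x\<close>, so it factors out on the right and leaves \<open>cochain i\<close>.\<close>

lemma nc_eval_solution:
  "nc_eval R (letter_value G R \<phi> \<sigma> \<tau> x) solution = (\<Oplus>i\<in>{..<3} \<times> {..<3}. cochain i \<otimes> translate i)"
proof -
  let ?L = "letter_value G R \<phi> \<sigma> \<tau> x"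
  have minus_one: "[(- 1::int)] \<cdot> r = \<ominus> r" if "r \<in> carrier R" for r
    using that by (simp add: add_pow_int_lt)
  have single: "nc_eval R ?L (Poly_Mapping.single [(word i j, b), (word k m, Letter_x)] (- 1))
      = \<ominus> ?L (word i j, b) \<otimes> act k m x" for i j k m b
    using letter_value_closed
    by (simp add: nc_eval_single[where V = "carrier G \<times> UNIV"] nc_monomial_def minus_one Pi_iff l_minus)
      (simp add: letter_value_def act_def)
  have var: "nc_variables (Poly_Mapping.single [(word i j, b), (word k m, Letter_x)] (- 1)) \<subseteq> carrier G \<times> UNIV"
    for i j k m b
    using nc_variables_single by fastforce
  have eval: "nc_eval R ?L (\<Sum>k<n. Poly_Mapping.single [(word (i k) (j k), b), (word m m', Letter_x)] (- 1))
      = (\<Oplus>k\<in>{..<n}. \<ominus> ?L (word (i k) (j k), b)) \<otimes> act m m' x" for n :: nat and i j b m m'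
  proof -
    have L: "?L (word (i k) (j k), b) \<in> carrier R" for k
      using letter_value_closed by auto
    have "nc_eval R ?L (\<Sum>k<n. Poly_Mapping.single [(word (i k) (j k), b), (word m m', Letter_x)] (- 1))
      = (\<Oplus>k\<in>{..<n}. \<ominus> ?L (word (i k) (j k), b) \<otimes> act m m' x)"
      by (subst nc_eval_sum[OF letter_value_closed _ var]) (auto simp: single)
    also have "\<dots> = (\<Oplus>k\<in>{..<n}. \<ominus> ?L (word (i k) (j k), b)) \<otimes> act m m' x"
      using L by (intro finsum_ldistr[symmetric]) auto
    finally show ?thesis .
  qed
  have var_sum: "nc_variables (\<Sum>k<n. Poly_Mapping.single [(word (i k) (j k), b), (word m m', Letter_x)] (- 1))
      \<subseteq> carrier G \<times> UNIV" for n :: nat and i j b m m'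
    by (rule subset_trans[OF nc_variables_sum]) (use var in blast)
  have L: "?L (word i j, Letter_b_sigma3) = act i j bs3" "?L (word i j, Letter_b_tau) = act i j bt" for i j
    by (simp_all add: letter_value_def act_def)
  define S1 S2 where "S1 i = (\<Sum>k<fst i. Poly_Mapping.single
      [(word (3 * k) 0, Letter_b_sigma3), (word (3 * fst i) (snd i), Letter_x)] (- 1 :: int))"
    and "S2 i = (\<Sum>k<snd i. Poly_Mapping.single
      [(word (3 * fst i) k, Letter_b_tau), (word (3 * fst i) (snd i), Letter_x)] (- 1 :: int))"
    for i :: "nat \<times> nat"
  have V: "nc_variables (S1 i) \<subseteq> carrier G \<times> UNIV" "nc_variables (S2 i) \<subseteq> carrier G \<times> UNIV" for i
    unfolding S1_def S2_def by (rule var_sum)+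
  have "nc_eval R ?L (S1 i + S2 i) = cochain i \<otimes> translate i" for i
  proof -
    have "nc_eval R ?L (S1 i + S2 i) = nc_eval R ?L (S1 i) \<oplus> nc_eval R ?L (S2 i)"
      by (rule nc_eval_add[OF letter_value_closed V])
    also have "\<dots> = (\<Oplus>k\<in>{..<fst i}. \<ominus> act (3 * k) 0 bs3) \<otimes> translate i
        \<oplus> (\<Oplus>k\<in>{..<snd i}. \<ominus> act (3 * fst i) k bt) \<otimes> translate i"
      unfolding S1_def S2_def eval by (simp only: L translate_def)
    also have "\<dots> = cochain i \<otimes> translate i"
      unfolding cochain_def by (intro l_distr[symmetric]) (auto intro!: finsum_closed)
    finally show ?thesis .
  qed
  moreover have "nc_eval R ?L solution = (\<Oplus>i\<in>{..<3} \<times> {..<3}. nc_eval R ?L (S1 i + S2 i))"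
    unfolding solution_def S1_def[symmetric] S2_def[symmetric]
    by (rule nc_eval_sum[OF letter_value_closed])
      (simp, rule subset_trans[OF nc_variables_add Un_least[OF V]])
  ultimately show ?thesis by simp
qed

lemma solves_solution: "solves_for_w G R \<phi> \<sigma> \<tau> x (nc_eval R (letter_value G R \<phi> \<sigma> \<tau> x) solution)"
  using coboundary_sigma3 coboundary_tau
  by (auto simp: solves_for_w_def nc_eval_solution act_words act_def intro!: finsum_closed)

section \<open>The invariant element \<open>a\<close> of an arbitrary solution
  \<open>w\<close>\<close>

context
  fixes w
  assumes w: "solves_for_w G R \<phi> \<sigma> \<tau> x w"
begin

abbreviation "a \<equiv> a_elem G R \<phi> \<sigma> \<tau> x w"

lemma w_closed [simp]: "w \<in> carrier R"
  using w by (simp add: solves_for_w_def)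

lemma sigma3_w: "act 3 0 w = w \<oplus> bs3" and tau_w: "act 0 1 w = w \<oplus> bt"
  using w by (auto simp: solves_for_w_def act_words intro!: add_solve)

lemma sigma4_w: "act 4 0 w = act 1 0 w \<oplus> act 1 0 bs3"
  and sigma4_tau_w: "act 4 1 w = act 1 0 w \<oplus> (act 1 0 bs3 \<oplus> act 4 0 bt)"
proof -
  have "act 4 0 w = act 1 0 (act 3 0 w)" "act 4 1 w = act 1 0 (act 3 0 (act 0 1 w))"
    by simp_all
  then show "act 4 0 w = act 1 0 w \<oplus> act 1 0 bs3" "act 4 1 w = act 1 0 w \<oplus> (act 1 0 bs3 \<oplus> act 4 0 bt)"
    by (simp_all add: sigma3_w tau_w a_assoc del: act_act) simp
qed

lemma a_eq: "a = bs \<oplus> (w \<ominus> act 1 0 w)"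
  by (simp add: a_elem_def act_words)

lemma a_elem_closed [simp]: "a \<in> carrier R"
  by (simp add: a_eq)

text \<open>Under \<open>\<sigma>^3\<close> the change of \<open>b(\<sigma>)\<close> cancels
  \<open>(1 - \<sigma>) b(\<sigma>^3)\<close>, because
  \<open>(1 - \<sigma>)(1 + \<sigma> + \<sigma>^2) = 1 - \<sigma>^3\<close>. Under \<tau>, rewriting
  \<open>\<tau> \<sigma> w\<close> as \<open>\<sigma>^4 \<tau> w\<close> reduces the claim to
  \<open>cocycle_relation\<close>.\<close>

lemma a_elem_fixed: "a \<in> fixed_elements R \<phi> (subgroup_U G \<sigma> \<tau>)"
proof -
  have "act 3 0 a = act 3 0 bs \<oplus> (w \<oplus> bs3 \<ominus> (act 1 0 w \<oplus> act 1 0 bs3))"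
    by (simp add: a_eq sigma3_w sigma4_w)
  also have "\<dots> = a"
    by (simp add: a_eq b_sigma3_eq)
      (use act_closed[OF b_sigma_closed] b_sigma_closed act_closed[OF w_closed] w_closed in algebra)
  finally have "act 3 0 a = a" .
  have "act 0 1 a = (act 0 1 bs \<oplus> bt) \<oplus> w \<ominus> (act 1 0 w \<oplus> (act 1 0 bs3 \<oplus> act 4 0 bt))"
    by (simp add: a_eq tau_w sigma4_tau_w ring_expand)
  also have "\<dots> = a"
    unfolding cocycle_relation a_eq
    using act_closed[OF b_sigma3_closed] act_closed[OF b_tau_closed] act_closed[OF w_closed]
      b_sigma_closed w_closed by algebra
  finally show ?thesis
    using \<open>act 3 0 a = a\<close> by (simp add: fixed_U_iff)
qed

text \<open>The terms in \<open>w\<close> telescope to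
  \<open>(1 - \<sigma>^3) w = -b(\<sigma>^3)\<close>, while those in \<open>b(\<sigma>)\<close> give
  \<open>b(\<sigma>^3) + 1\<close>.\<close>

lemma a_elem_trace: "a \<oplus> act 1 0 a \<oplus> act 2 0 a = \<one>"
proof -
  have "a \<oplus> act 1 0 a \<oplus> act 2 0 a = (bs3 \<oplus> \<one>) \<oplus> (w \<ominus> act 3 0 w)"
    by (simp add: a_eq b_sigma3_eq)
      (use act_closed[OF b_sigma_closed] b_sigma_closed act_closed[OF w_closed] w_closed in algebra)
  also have "\<dots> = \<one>"
    unfolding sigma3_w using b_sigma3_closed w_closed by algebra
  finally show ?thesis .
qed

text \<open>An element invariant under \<open>U\<close> comes out of the norm over \<open>U\<close>
  on either side, leaving the norm of \<open>x\<close>, which is 1.\<close>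

lemma norm_ax: "action_norm R \<phi> (subgroup_U G \<sigma> \<tau>) (a \<otimes> x) = a"
  and norm_xa: "action_norm R \<phi> (subgroup_U G \<sigma> \<tau>) (x \<otimes> a) = a"
proof -
  have fixU: "act (3 * p) q a = a" if "p < 3" "q < 3" for p q
    using a_elem_fixed that by (auto simp: fixed_elements_def subgroup_U_word act_def)
  have N: "(\<Oplus>i\<in>{..<3} \<times> {..<3}. act (3 * fst i) (snd i) x) = \<one>"
    using norm_U by (simp add: action_norm_U)
  have "action_norm R \<phi> (subgroup_U G \<sigma> \<tau>) (a \<otimes> x) = (\<Oplus>i\<in>{..<3} \<times> {..<3}. a \<otimes> act (3 * fst i) (snd i) x)"
    by (simp add: action_norm_U, intro finsum_cong') (auto simp: act_mult fixU)
  also have "\<dots> = a"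
    by (simp add: finsum_rdistr[symmetric] N)
  finally show "action_norm R \<phi> (subgroup_U G \<sigma> \<tau>) (a \<otimes> x) = a" .
  have "action_norm R \<phi> (subgroup_U G \<sigma> \<tau>) (x \<otimes> a) = (\<Oplus>i\<in>{..<3} \<times> {..<3}. act (3 * fst i) (snd i) x \<otimes> a)"
    by (simp add: action_norm_U, intro finsum_cong') (auto simp: act_mult fixU)
  also have "\<dots> = a"
    by (simp add: finsum_ldistr[symmetric] N)
  finally show "action_norm R \<phi> (subgroup_U G \<sigma> \<tau>) (x \<otimes> a) = a" .
qed

text \<open>The norm over \<open>G\<close> is taken in stages: the norm over \<open>U\<close> yields
  \<open>a\<close>, and the trace of \<open>a\<close> over the powers 1, \<sigma>,
  \<open>\<sigma>^2\<close> is 1.\<close>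

lemma norm_G: "y \<in> {a \<otimes> x, x \<otimes> a} \<Longrightarrow> action_norm R \<phi> (carrier G) y = \<one>"
  using norm_ax norm_xa a_elem_trace by (auto simp: action_norm_carrier)

end

end

text \<open>The polynomial is chosen before the ring, the action and \<open>x\<close>, hence is
  uniform in them; the claims on \<open>a\<close> cover every solution \<open>w\<close>, not only
  the one that the polynomial yields.\<close>

theorem mainTheorem5:
  fixes G :: "('g, 'm) monoid_scheme" and \<sigma> \<tau> :: 'g
  assumes "G27 G \<sigma> \<tau>"
  shows "\<exists>P :: ('g \<times> letter) list \<Rightarrow>\<^sub>0 int.
    nc_variables P \<subseteq> subgroup_U G \<sigma> \<tau> \<times> UNIV \<and>
    (\<forall>(R :: ('r, 'n) ring_scheme) \<phi> x.
      ring_action G R \<phi> \<longrightarrow> x \<in> carrier R \<longrightarrow> action_norm R \<phi> (subgroup_U G \<sigma> \<tau>) x = \<one>\<^bsub>R\<^esub> \<longrightarrow>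
        x_prime G R \<phi> \<sigma> \<tau> x \<in> carrier R \<and>
        action_norm R \<phi> (subgroup_H' G \<sigma> \<tau>) (x_prime G R \<phi> \<sigma> \<tau> x) = \<one>\<^bsub>R\<^esub> \<and>
        solves_for_w G R \<phi> \<sigma> \<tau> x (nc_eval R (letter_value G R \<phi> \<sigma> \<tau> x) P) \<and>
        (\<forall>w. solves_for_w G R \<phi> \<sigma> \<tau> x w \<longrightarrow>
          (let a = a_elem G R \<phi> \<sigma> \<tau> x w in
            a \<in> fixed_elements R \<phi> (subgroup_U G \<sigma> \<tau>) \<and>
            action_norm R (coset_action \<phi>) (carrier (G Mod subgroup_U G \<sigma> \<tau>)) a
              = a \<oplus>\<^bsub>R\<^esub> \<phi> \<sigma> a \<oplus>\<^bsub>R\<^esub> \<phi> (\<sigma> [^]\<^bsub>G\<^esub> (2::nat)) a \<and>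
            a \<oplus>\<^bsub>R\<^esub> \<phi> \<sigma> a \<oplus>\<^bsub>R\<^esub> \<phi> (\<sigma> [^]\<^bsub>G\<^esub> (2::nat)) a = \<one>\<^bsub>R\<^esub> \<and>
            (\<forall>y \<in> {a \<otimes>\<^bsub>R\<^esub> x, x \<otimes>\<^bsub>R\<^esub> a}. action_norm R \<phi> (carrier G) y = \<one>\<^bsub>R\<^esub>))))"
proof -
  interpret G27 G \<sigma> \<tau> by fact
  show ?thesis
  proof (intro exI[of _ solution] conjI allI impI)
    show "nc_variables solution \<subseteq> subgroup_U G \<sigma> \<tau> \<times> UNIV"
      by (rule nc_variables_solution)
    fix R :: "('r, 'n) ring_scheme" and \<phi> x
    assume "ring_action G R \<phi>" and x: "x \<in> carrier R"
      and norm: "action_norm R \<phi> (subgroup_U G \<sigma> \<tau>) x = \<one>\<^bsub>R\<^esub>"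
    then interpret ring_action G R \<phi> by simp
    interpret G27_norm_one G \<sigma> \<tau> R \<phi> x
      by unfold_locales (fact x norm)+
    show "x_prime G R \<phi> \<sigma> \<tau> x \<in> carrier R"
      by (rule x_prime_closed)
    show "action_norm R \<phi> (subgroup_H' G \<sigma> \<tau>) (x_prime G R \<phi> \<sigma> \<tau> x) = \<one>\<^bsub>R\<^esub>"
      by (rule norm_H')
    show "solves_for_w G R \<phi> \<sigma> \<tau> x (nc_eval R (letter_value G R \<phi> \<sigma> \<tau> x) solution)"
      by (rule solves_solution)
    fix w assume w: "solves_for_w G R \<phi> \<sigma> \<tau> x w"
    show "let a = a_elem G R \<phi> \<sigma> \<tau> x w in
            a \<in> fixed_elements R \<phi> (subgroup_U G \<sigma> \<tau>) \<and>
            action_norm R (coset_action \<phi>) (carrier (G Mod subgroup_U G \<sigma> \<tau>)) a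
              = a \<oplus>\<^bsub>R\<^esub> \<phi> \<sigma> a \<oplus>\<^bsub>R\<^esub> \<phi> (\<sigma> [^]\<^bsub>G\<^esub> (2::nat)) a \<and>
            a \<oplus>\<^bsub>R\<^esub> \<phi> \<sigma> a \<oplus>\<^bsub>R\<^esub> \<phi> (\<sigma> [^]\<^bsub>G\<^esub> (2::nat)) a = \<one>\<^bsub>R\<^esub> \<and>
            (\<forall>y \<in> {a \<otimes>\<^bsub>R\<^esub> x, x \<otimes>\<^bsub>R\<^esub> a}. action_norm R \<phi> (carrier G) y = \<one>\<^bsub>R\<^esub>)"
      unfolding Let_def act_words
      using a_elem_fixed[OF w] action_norm_quotient[OF a_elem_closed[OF w] a_elem_fixed[OF w]]
        a_elem_trace[OF w] norm_G[OF w] by blast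
  qed
qed

end
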